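(* Let $T:\bigcup_{n=1}^\infty I_n\to(0,1)$ be a countable branched system satisfying properties (1)--(5) listed in the context, and let $s_0=\inf\{s:\sum_{n=1}^\infty|I_n|^s<\infty\}$. Suppose there exists a probability vector $\mathbf p$ such that $\dim\mu_{\mathbf p}>s_0$. Then there exists a probability vector $\mathbf p^*$ such that $$\sup_{\mathbf p}\dim\mu_{\mathbf p}=\dim\mu_{\mathbf p^*},$$ where the supremum is over all probability vectors $\mathbf p=(p_i)_{i=1}^\infty$.
   Context: Setting. $\{I_n=(a_n,b_n)\}_{n=1}^\infty$ is a countable collection of disjoint open subintervals of $(0,1)$ such that either $a_1=0$, $b_n=a_{n+1}$ for all $n\in\mathbb{N}$ and $\lim_{n\to\infty}b_n=1$, or $b_1=1$, $b_{n+1}=a_n$ for all $n\in\mathbb{N}$ and $\lim_{n\to\infty}a_n=0$. For each $n$, $T_n:I_n\to(0,1)$ is a $C^2$ bijection onto $(0,1)$; either every $T_n$ is orientation preserving or every $T_n$ is orientation reversing, and $T$ is called orientation preserving or reversing accordingly. $T:\bigcup_n I_n\to(0,1)$ is given by $T(x)=T_n(x)$ for $x\in I_n$. Properties (iterates of $T$ being considered at the points where they are defined): (1) The derivative $T'$ is monotone on $\bigcup_n I_n$. (2) If $T$ is orientation reversing and $T'$ is increasing, then for any $n$ and $x,y\in I_n$ with $x\ge y$, $(T^2)'(x)\ge(T^2)'(y)$. If $T$ is orientation reversing and $T'$ is decreasing, then for any $n$ and $x,y\in I_n$ with $x\ge y$, $(T^2)'(x)\le(T^2)'(y)$. (3)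 There exist $l\in\mathbb{N}$ and $\Lambda>1$ such that $|(T^l)'(x)|\ge\Lambda$ for all $x\in[0,1]$ at which $T^l$ is defined. (4) There exists $\kappa<\infty$ such that $\sup_{n\in\mathbb{N}}\sup_{x,y,z\in I_n}\left|\frac{T''(x)}{T'(y)T'(z)}\right|\le\kappa$. (5) There exists $s\in(0,1)$ such that $\sum_{n=1}^\infty|I_n|^s<\infty$. Coding and measures. $\phi_n:(0,1)\to I_n$ is the inverse of $T_n$; $\phi_{a_1,\ldots,a_n}=\phi_{a_1}\circ\cdots\circ\phi_{a_n}$ and $I_{a_1,\ldots,a_n}=\phi_{a_1,\ldots,a_n}((0,1))$. The coding map $\Pi:\mathbb{N}^{\mathbb{N}}\to[0,1]$ is $\Pi((a_i))=\bigcap_{n=1}^\infty\overline{I_{a_1,\ldots,a_n}}$ (the unique point of this intersection). A probability vector is $\mathbf p=(p_i)_{i=1}^\infty$ with $p_i\ge0$, $\sum_i p_i=1$; $m_{\mathbf p}$ is the associated Bernoulli (product) measure on $\mathbb{N}^{\mathbb{N}}$, and $\mu_{\mathbf p}:=\Pi_*m_{\mathbf p}=m_{\mathbf p}\circ\Pi^{-1}$. For a Borel probability measure $\mu$ supported on $[0,1]$, $\dim(\mu):=\inf\{\dim_H(A):\mu(A)=1\}$, where $\dim_H$ is Hausdorff dimension and $A$ ranges over Borel sets. *)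

theory Defs
  imports "HOL-Probability.Probability"
begin

text \<open>Branches, probability vectors and coding sequences are indexed by
  \<^typ>\<open>nat\<close> from 0 instead of by $1, 2, 3, \ldots$.\<close>

section \<open>Hausdorff dimension\<close>

text \<open>The $s$-th power of the diameter, with $|\emptyset|^s = 0$ and $|U|^0 = 1$ for
  nonempty $U$. A separate definition is needed as \<^term>\<open>0 powr 0 = (0::real)\<close>.\<close>

definition diam_pow :: "real \<Rightarrow> 'a::metric_space set \<Rightarrow> real" where
  "diam_pow s U = (if U = {} then 0 else if s = 0 then 1 else diameter U powr s)"

text \<open>Boundedness of the covering sets is required explicitly because
  \<^const>\<open>diameter\<close> is unspecified on unbounded sets.\<close>

definition hausdorff_premeasure :: "real \<Rightarrow> real \<Rightarrow> 'a::metric_space set \<Rightarrow> ennreal" where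
  "hausdorff_premeasure s \<delta> A =
     Inf {(\<Sum>i. ennreal (diam_pow s (U i))) | U :: nat \<Rightarrow> 'a set.
            A \<subseteq> (\<Union>i. U i) \<and> (\<forall>i. bounded (U i) \<and> diameter (U i) \<le> \<delta>)}"

definition hausdorff_measure :: "real \<Rightarrow> 'a::metric_space set \<Rightarrow> ennreal" where
  "hausdorff_measure s A = (SUP \<delta>\<in>{0<..}. hausdorff_premeasure s \<delta> A)"

definition hausdorff_dim :: "'a::metric_space set \<Rightarrow> ereal" where
  "hausdorff_dim A = Inf {ereal s | s. 0 \<le> s \<and> hausdorff_measure s A = 0}"

definition measure_dim :: "'a::metric_space measure \<Rightarrow> ereal" where
  "measure_dim \<mu> = (INF A\<in>{A \<in> sets borel. emeasure \<mu> A = 1}. hausdorff_dim A)"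

section \<open>Countable branched systems\<close>

definition branch_interval :: "(nat \<Rightarrow> real) \<Rightarrow> (nat \<Rightarrow> real) \<Rightarrow> nat \<Rightarrow> real set" where
  "branch_interval a b n = {a n<..<b n}"

definition branch_domain :: "(nat \<Rightarrow> real) \<Rightarrow> (nat \<Rightarrow> real) \<Rightarrow> real set" where
  "branch_domain a b = (\<Union>n. branch_interval a b n)"

definition orientation_preserving ::
  "(nat \<Rightarrow> real) \<Rightarrow> (nat \<Rightarrow> real) \<Rightarrow> (real \<Rightarrow> real) \<Rightarrow> bool" where
  "orientation_preserving a b T \<longleftrightarrow> (\<forall>n. strict_mono_on (branch_interval a b n) T)"

definition orientation_reversing ::
  "(nat \<Rightarrow> real) \<Rightarrow> (nat \<Rightarrow> real) \<Rightarrow> (real \<Rightarrow> real) \<Rightarrow> bool" where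
  "orientation_reversing a b T \<longleftrightarrow> (\<forall>n. strict_antimono_on (branch_interval a b n) T)"

text \<open>\<^term>\<open>T\<close> is total, but only its values on \<^term>\<open>branch_domain a b\<close> matter. As this
  set is open, \<^term>\<open>deriv T\<close> and \<^term>\<open>deriv (deriv T)\<close> at its points do not depend on
  values of \<^term>\<open>T\<close> elsewhere.\<close>

definition countable_branched_system ::
  "(nat \<Rightarrow> real) \<Rightarrow> (nat \<Rightarrow> real) \<Rightarrow> (real \<Rightarrow> real) \<Rightarrow> bool" where
  "countable_branched_system a b T \<longleftrightarrow>
     (\<forall>n. a n < b n) \<and>
     (\<forall>n. branch_interval a b n \<subseteq> {0<..<1}) \<and>
     disjoint_family (branch_interval a b) \<and>
     ((a 0 = 0 \<and> (\<forall>n. b n = a (Suc n)) \<and> b \<longlonglongrightarrow> 1) \<or>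
      (b 0 = 1 \<and> (\<forall>n. b (Suc n) = a n) \<and> a \<longlonglongrightarrow> 0)) \<and>
     (\<forall>n. bij_betw T (branch_interval a b n) {0<..<1}) \<and>
     (\<forall>n. T differentiable_on branch_interval a b n \<and>
          deriv T differentiable_on branch_interval a b n \<and>
          continuous_on (branch_interval a b n) (deriv (deriv T))) \<and>
     (orientation_preserving a b T \<or> orientation_reversing a b T)"

text \<open>The points at which the $k$-th iterate of the partial map is defined. This set is open
  for a branched system, so \<^term>\<open>deriv (T ^^ k)\<close> is the derivative of the partial map there.\<close>

definition iterate_domain ::
  "(nat \<Rightarrow> real) \<Rightarrow> (nat \<Rightarrow> real) \<Rightarrow> (real \<Rightarrow> real) \<Rightarrow> nat \<Rightarrow> real set" where
  "iterate_domain a b T k = {x. \<forall>j<k. (T ^^ j) x \<in> branch_domain a b}"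

definition monotone_derivative ::
  "(nat \<Rightarrow> real) \<Rightarrow> (nat \<Rightarrow> real) \<Rightarrow> (real \<Rightarrow> real) \<Rightarrow> bool" where
  "monotone_derivative a b T \<longleftrightarrow>
     mono_on (branch_domain a b) (deriv T) \<or> antimono_on (branch_domain a b) (deriv T)"

definition second_iterate_condition ::
  "(nat \<Rightarrow> real) \<Rightarrow> (nat \<Rightarrow> real) \<Rightarrow> (real \<Rightarrow> real) \<Rightarrow> bool" where
  "second_iterate_condition a b T \<longleftrightarrow>
     (orientation_reversing a b T \<and> mono_on (branch_domain a b) (deriv T) \<longrightarrow>
       (\<forall>n. \<forall>x \<in> branch_interval a b n \<inter> iterate_domain a b T 2.
            \<forall>y \<in> branch_interval a b n \<inter> iterate_domain a b T 2.
              x \<ge> y \<longrightarrow> deriv (T ^^ 2) x \<ge> deriv (T ^^ 2) y)) \<and>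
     (orientation_reversing a b T \<and> antimono_on (branch_domain a b) (deriv T) \<longrightarrow>
       (\<forall>n. \<forall>x \<in> branch_interval a b n \<inter> iterate_domain a b T 2.
            \<forall>y \<in> branch_interval a b n \<inter> iterate_domain a b T 2.
              x \<ge> y \<longrightarrow> deriv (T ^^ 2) x \<le> deriv (T ^^ 2) y))"

definition eventually_expanding ::
  "(nat \<Rightarrow> real) \<Rightarrow> (nat \<Rightarrow> real) \<Rightarrow> (real \<Rightarrow> real) \<Rightarrow> bool" where
  "eventually_expanding a b T \<longleftrightarrow>
     (\<exists>l\<ge>1. \<exists>\<Lambda>>1. \<forall>x \<in> {0..1} \<inter> iterate_domain a b T l. \<bar>deriv (T ^^ l) x\<bar> \<ge> \<Lambda>)"

text \<open>The convention \<^term>\<open>x / 0 = (0::real)\<close> plays no role below: for a branched system with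
  monotone derivative, \<^term>\<open>deriv T\<close> has no zero on the domain (a zero would force it to vanish
  on a whole one-sided neighbourhood, contradicting injectivity).\<close>

definition bounded_distortion ::
  "(nat \<Rightarrow> real) \<Rightarrow> (nat \<Rightarrow> real) \<Rightarrow> (real \<Rightarrow> real) \<Rightarrow> bool" where
  "bounded_distortion a b T \<longleftrightarrow>
     (\<exists>\<kappa>::real. \<forall>n. \<forall>x \<in> branch_interval a b n. \<forall>y \<in> branch_interval a b n.
        \<forall>z \<in> branch_interval a b n. \<bar>deriv (deriv T) x / (deriv T y * deriv T z)\<bar> \<le> \<kappa>)"

definition summable_lengths :: "(nat \<Rightarrow> real) \<Rightarrow> (nat \<Rightarrow> real) \<Rightarrow> real \<Rightarrow> bool" where
  "summable_lengths a b s \<longleftrightarrow> summable (\<lambda>n. (b n - a n) powr s)"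

text \<open>The infimum is over all real exponents. No $s \le 0$ is admissible, since all lengths lie
  in $(0, 1]$, so the set is bounded below.\<close>

definition critical_exponent :: "(nat \<Rightarrow> real) \<Rightarrow> (nat \<Rightarrow> real) \<Rightarrow> real" where
  "critical_exponent a b = Inf {s. summable_lengths a b s}"

section \<open>Coding and Bernoulli measures\<close>

definition inverse_branch ::
  "(nat \<Rightarrow> real) \<Rightarrow> (nat \<Rightarrow> real) \<Rightarrow> (real \<Rightarrow> real) \<Rightarrow> nat \<Rightarrow> real \<Rightarrow> real" where
  "inverse_branch a b T n = the_inv_into (branch_interval a b n) T"

primrec inverse_word ::
  "(nat \<Rightarrow> real) \<Rightarrow> (nat \<Rightarrow> real) \<Rightarrow> (real \<Rightarrow> real) \<Rightarrow> nat list \<Rightarrow> real \<Rightarrow> real" where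
  "inverse_word a b T [] = id"
| "inverse_word a b T (k # w) = inverse_branch a b T k \<circ> inverse_word a b T w"

definition cylinder_interval ::
  "(nat \<Rightarrow> real) \<Rightarrow> (nat \<Rightarrow> real) \<Rightarrow> (real \<Rightarrow> real) \<Rightarrow> nat list \<Rightarrow> real set" where
  "cylinder_interval a b T w = inverse_word a b T w ` {0<..<1}"

definition coding_map ::
  "(nat \<Rightarrow> real) \<Rightarrow> (nat \<Rightarrow> real) \<Rightarrow> (real \<Rightarrow> real) \<Rightarrow> (nat \<Rightarrow> nat) \<Rightarrow> real" where
  "coding_map a b T \<omega> =
     (THE x. x \<in> (\<Inter>n\<in>{1..}. closure (cylinder_interval a b T (map \<omega> [0..<n]))))"

definition prob_vector :: "(nat \<Rightarrow> real) \<Rightarrow> bool" where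
  "prob_vector p \<longleftrightarrow> (\<forall>i. 0 \<le> p i) \<and> p sums 1"

definition bernoulli_measure :: "(nat \<Rightarrow> real) \<Rightarrow> (nat \<Rightarrow> nat) measure" where
  "bernoulli_measure p = (\<Pi>\<^sub>M i\<in>UNIV. point_measure UNIV (\<lambda>k. ennreal (p k)))"

definition coded_measure ::
  "(nat \<Rightarrow> real) \<Rightarrow> (nat \<Rightarrow> real) \<Rightarrow> (real \<Rightarrow> real) \<Rightarrow> (nat \<Rightarrow> real) \<Rightarrow> real measure" where
  "coded_measure a b T p = distr (bernoulli_measure p) borel (coding_map a b T)"

end

theory Submission
  imports Defs
begin

text \<open>
  For a Bernoulli measure let \<open>H\<close> be the entropy of a block of \<open>k\<close> symbols and \<open>\<Lambda>\<close> the mean of \<open>- ln (L w)\<close>,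
  where \<open>L w\<close> is the length of the cylinder of the word \<open>w\<close>. The dimension is essentially
  \<open>H / \<Lambda>\<close>, and the supremum is attained because \<open>H - t * \<Lambda>\<close> is upper semicontinuous in the
  probability vector for every \<open>t\<close> above the critical exponent, on a tight set of vectors.

  Geometry enters only through the lengths. Bounded distortion and expansion make \<open>L\<close>
  quasi-multiplicative, \<open>L (u @ v)\<close> being \<open>L u * L v\<close> up to a factor \<open>C\<close>, and exponentially
  decreasing (\<open>branched_system.cylinder_system\<close>). The mean of \<open>- ln (L w)\<close> over blocks of length \<open>k\<close> grows
  linearly in \<open>k\<close> while the distortion error stays bounded, so it is enough to compare \<open>H\<close> with
  \<open>t * \<Lambda>\<close> up to a bounded error, for all \<open>k\<close>. This comparison is the predicate \<open>dominates p t k\<close>,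
  which says that the sum over words of length \<open>k\<close> of \<open>m * ln ((C * L w) powr t / m)\<close>, with \<open>m\<close> the
  mass of the word, converges and is nonnegative.

  If the dimension exceeds a number \<open>t\<close> above the critical exponent, then \<open>p\<close> dominates (\<open>dominates_if_dim_gt\<close>): otherwise the mass of
  typical cylinders would exceed \<open>L w powr t\<close> by an exponential factor, and covering by these cylinders would
  give dimension at most \<open>t\<close>. Dominance is closed under pointwise limits of probability vectors
  (\<open>dominates_limit\<close>): a single term is at most \<open>(C * L w) powr t\<close>, which is summable and independent
  of \<open>p\<close>, so Fatou's lemma applies. Comparing two exponents above the critical one bounds \<open>\<Lambda>\<close>
  uniformly (\<open>dominates_lyapunov\<close>), which makes a maximizing sequence tight. Finally dominance at \<open>t\<close>
  for all \<open>k\<close> implies dimension at least \<open>t'\<close> for each \<open>t' < t\<close> (\<open>measure_dim_ge_if_dominates\<close>), by the mass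
  distribution principle.

  Both dimension estimates need almost sure bounds for sums of i.i.d. variables with a mean but
  possibly no higher moment. Only one-sided bounds occur, and these follow from the maximal ergodic
  theorem together with the zero-one law (\<open>block_sums_bounded\<close>).
\<close>

section \<open>Ergodic sums with negative mean\<close>

text \<open>The maximal ergodic theorem in Garsia's form. The running maxima \<open>m n\<close> of the ergodic sums satisfy
  \<open>m (n + 1) x = max 0 (f x + m n (\<theta> x))\<close>. On the invariant set \<open>A\<close> where the sums are
  unbounded, \<open>m (n + 1) - m n \<circ> \<theta>\<close> converges to \<open>f\<close>, is dominated by \<open>\<bar>f\<bar>\<close>, and has a
  nonnegative integral over \<open>A\<close>, because \<open>m\<close> increases and \<open>\<theta>\<close> preserves the measure.\<close>

lemma maximal_ergodic_nonneg:
  fixes f :: "'a \<Rightarrow> real"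
  assumes M: "prob_space M"
    and \<theta>: "\<theta> \<in> M \<rightarrow>\<^sub>M M" "distr M M \<theta> = M"
    and f: "integrable M f"
  defines "A \<equiv> {x \<in> space M. \<not> (\<exists>K. \<forall>n. (\<Sum>j<n. f ((\<theta> ^^ j) x)) \<le> K)}"
  shows "A \<in> sets M"
    and "x \<in> space M \<Longrightarrow> \<theta> x \<in> A \<longleftrightarrow> x \<in> A"
    and "0 \<le> (\<integral>x. indicator A x * f x \<partial>M)"
proof -
  interpret prob_space M by fact
  define S where "S n x = (\<Sum>j<n. f ((\<theta> ^^ j) x))" for n x
  have [measurable]: "f \<in> borel_measurable M" using f by auto
  have [measurable]: "\<theta> \<in> M \<rightarrow>\<^sub>M M" by fact
  have iter[measurable]: "(\<theta> ^^ n) \<in> M \<rightarrow>\<^sub>M M" for n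
    by (induction n) auto
  have [measurable]: "S n \<in> borel_measurable M" for n
    unfolding S_def by measurable
  have S_Suc: "S (Suc n) x = f x + S n (\<theta> x)" for n x
    unfolding S_def by (subst sum.lessThan_Suc_shift) (simp add: funpow_swap1)
  have A_alt: "A = {x \<in> space M. \<forall>K::nat. \<exists>n. S n x > real K}"
  proof -
    have "(\<exists>K. \<forall>n. S n x \<le> K) \<longleftrightarrow> (\<exists>K::nat. \<forall>n. S n x \<le> real K)" for x
      by (meson real_arch_simple order_trans)
    then show ?thesis unfolding A_def S_def[symmetric]
      by (auto simp: not_le)
  qed
  show A[measurable]: "A \<in> sets M" unfolding A_alt by measurable
  show inv: "\<theta> x \<in> A \<longleftrightarrow> x \<in> A" if x: "x \<in> space M" for x
  proof -
    have "\<theta> x \<in> space M" using x by (meson \<theta>(1) measurable_space)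
    moreover have "(\<exists>K. \<forall>n. S n (\<theta> x) \<le> K) \<longleftrightarrow> (\<exists>K. \<forall>n. S n x \<le> K)"
    proof
      assume "\<exists>K. \<forall>n. S n (\<theta> x) \<le> K"
      then obtain K where K: "\<And>n. S n (\<theta> x) \<le> K" by auto
      have "S n x \<le> max 0 (f x + K)" for n
        using K[of "n - 1"] S_Suc[of "n-1" x] by (cases n) (auto simp: S_def)
      then show "\<exists>K. \<forall>n. S n x \<le> K" by blast
    next
      assume "\<exists>K. \<forall>n. S n x \<le> K"
      then obtain K where K: "\<And>n. S n x \<le> K" by auto
      have "S n (\<theta> x) \<le> K - f x" for n using K[of "Suc n"] S_Suc[of n x] by simp
      then show "\<exists>K. \<forall>n. S n (\<theta> x) \<le> K" by blast
    qed
    ultimately show ?thesis using x unfolding A_def S_def[symmetric] by auto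
  qed
  define m where "m = rec_nat (\<lambda>x. 0) (\<lambda>n g x. max 0 (f x + g (\<theta> x)))"
  have m0: "m 0 x = 0" and mS: "m (Suc n) x = max 0 (f x + m n (\<theta> x))" for n x
    by (auto simp: m_def)
  have inv_int: "integrable M (\<lambda>x. g (\<theta> x))" "(\<integral>x. g (\<theta> x) \<partial>M) = (\<integral>x. g x \<partial>M)"
    if "integrable M g" for g :: "'a \<Rightarrow> real"
  proof -
    have "integrable (distr M M \<theta>) g" by (simp add: \<theta>(2) that)
    then show "integrable M (\<lambda>x. g (\<theta> x))" by (subst (asm) integrable_distr_eq) (use that in auto)
    have "(\<integral>x. g x \<partial>(distr M M \<theta>)) = (\<integral>x. g (\<theta> x) \<partial>M)"
      by (rule integral_distr) (use that in auto)
    then show "(\<integral>x. g (\<theta> x) \<partial>M) = (\<integral>x. g x \<partial>M)" by (simp add: \<theta>(2))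
  qed
  have mint: "integrable M (m n)" for n
  proof (induction n)
    case 0 show ?case by (simp add: m0[abs_def])
  next
    case (Suc n)
    have "integrable M (\<lambda>x. max 0 (f x + m n (\<theta> x)))"
      using inv_int(1)[OF Suc] f by auto
    then show ?case by (simp add: mS[abs_def])
  qed
  have m_nonneg: "0 \<le> m n x" for n x by (cases n) (auto simp: m0 mS)
  have m_mono1: "m n x \<le> m (Suc n) x" for n x
  proof (induction n arbitrary: x)
    case 0 then show ?case by (simp add: m0 mS)
  next
    case (Suc n)
    show ?case using Suc[of "\<theta> x"] unfolding mS[of n x] mS[of "Suc n" x] by (intro max.mono) auto
  qed
  have m_mono: "incseq (\<lambda>n. m n x)" for x using m_mono1 by (rule incseq_SucI)
  have S_le_m: "S n x \<le> m n x" for n x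
  proof (induction n arbitrary: x)
    case 0 then show ?case by (simp add: m0 S_def)
  next
    case (Suc n)
    show ?case using Suc[of "\<theta> x"] unfolding mS S_Suc by linarith
  qed
  define g where "g n x = indicator A x * (m (Suc n) x - m n (\<theta> x))" for n x
  have intA: "integrable M (\<lambda>x. indicator A x * h x)" if "integrable M h" for h :: "'a \<Rightarrow> real"
    using integrable_mult_indicator[OF A that] by simp
  have g_nonneg: "0 \<le> (\<integral>x. g n x \<partial>M)" for n
  proof -
    have "(\<integral>x. indicator A x * m n (\<theta> x) \<partial>M) = (\<integral>x. indicator A (\<theta> x) * m n (\<theta> x) \<partial>M)"
      by (rule Bochner_Integration.integral_cong) (auto simp: inv indicator_def)
    also have "\<dots> = (\<integral>x. indicator A x * m n x \<partial>M)"
      using inv_int(2)[OF intA[OF mint[of n]]] .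
    also have "\<dots> \<le> (\<integral>x. indicator A x * m (Suc n) x \<partial>M)"
      by (intro integral_mono intA mint mult_left_mono m_mono1) auto
    finally show ?thesis
      unfolding g_def right_diff_distrib
      by (subst Bochner_Integration.integral_diff) (auto intro!: intA mint inv_int)
  qed
  have "(\<lambda>n. \<integral>x. g n x \<partial>M) \<longlonglongrightarrow> (\<integral>x. indicator A x * f x \<partial>M)"
  proof (rule integral_dominated_convergence)
    show "integrable M (\<lambda>x. \<bar>f x\<bar>)" using f by auto
    show "AE x in M. (\<lambda>n. g n x) \<longlonglongrightarrow> indicator A x * f x"
    proof (rule AE_I2)
      fix x assume x: "x \<in> space M"
      show "(\<lambda>n. g n x) \<longlonglongrightarrow> indicator A x * f x"
      proof (cases "x \<in> A")
        case False then show ?thesis by (simp add: g_def)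
      next
        case True
        then have "\<theta> x \<in> A" using inv x by auto
        then obtain k where "S k (\<theta> x) > real (nat \<lceil>- f x\<rceil>)" unfolding A_alt by blast
        then have k: "- f x \<le> m k (\<theta> x)" using S_le_m[of k "\<theta> x"] by linarith
        have "g n x = f x" if "n \<ge> k" for n
          using k incseqD[OF m_mono that, of "\<theta> x"] True by (auto simp: g_def mS)
        then show ?thesis using True
          by (intro tendsto_eventually) (auto simp: eventually_sequentially)
      qed
    qed
    show "AE x in M. norm (g n x) \<le> \<bar>f x\<bar>" for n
      using m_nonneg[of n] by (intro AE_I2) (auto simp: g_def mS indicator_def max_def not_le abs_if; smt (verit))
    show "g n \<in> borel_measurable M" for n
      unfolding g_def using mint inv_int(1)[OF mint] by auto
  qed auto
  then show "0 \<le> (\<integral>x. indicator A x * f x \<partial>M)"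
    using g_nonneg by (auto intro: LIMSEQ_le_const)
qed


section \<open>Bernoulli measures on sequences\<close>

abbreviation shift :: "nat \<Rightarrow> (nat \<Rightarrow> nat) \<Rightarrow> nat \<Rightarrow> nat" where
  "shift k \<omega> \<equiv> (\<lambda>i. \<omega> (i + k))"

abbreviation prefix :: "nat \<Rightarrow> (nat \<Rightarrow> nat) \<Rightarrow> nat list" where
  "prefix n \<omega> \<equiv> map \<omega> [0..<n]"

lemma prefix_eq_iff: "prefix n \<omega> = w \<longleftrightarrow> length w = n \<and> (\<forall>i<n. \<omega> i = w ! i)"
  by (subst list_eq_iff_nth_eq) auto

lemma prefix_block: "prefix (n * k) \<omega> = concat (map (\<lambda>j. prefix k (shift (j * k) \<omega>)) [0..<n])"
proof (induction n)
  case (Suc n)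
  have "map \<omega> [n * k..<n * k + k] = prefix k (shift (n * k) \<omega>)"
    by (rule nth_equalityI) (auto simp: add.commute)
  moreover have "[0..<Suc n * k] = [0..<n * k] @ [n * k..<n * k + k]"
    using upt_add_eq_append[of 0 "n * k" k] by (simp add: add.commute)
  ultimately show ?case using Suc by simp
qed simp

abbreviation words :: "nat \<Rightarrow> nat list set" where
  "words k \<equiv> {w. length w = k}"

definition word_mass :: "(nat \<Rightarrow> real) \<Rightarrow> nat list \<Rightarrow> real" where
  "word_mass p w = prod_list (map p w)"

text \<open>All estimates are made on blocks of a fixed length \<open>k\<close>: a function of the first \<open>k\<close> symbols has
  i.i.d. values along \<open>shift k\<close>, and its expectation is a sum over \<open>words k\<close>.\<close>

locale bernoulli =
  fixes p :: "nat \<Rightarrow> real"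
  assumes p: "prob_vector p"
begin

abbreviation "B \<equiv> bernoulli_measure p"
abbreviation "letter_measure \<equiv> point_measure UNIV (\<lambda>k. ennreal (p k))"

lemma p_nonneg: "0 \<le> p i" and p_sums: "p sums 1"
  using p by (auto simp: prob_vector_def)

lemma sets_P0[measurable_cong]: "sets letter_measure = sets (count_space UNIV)"
  by (simp add: sets_point_measure)

lemma space_P0: "space letter_measure = UNIV"
  by (simp add: space_point_measure)

lemma prob_space_P0: "prob_space letter_measure"
proof
  have "emeasure letter_measure (space letter_measure) = (\<integral>\<^sup>+x. ennreal (p x) \<partial>count_space UNIV)"
    by (simp add: point_measure_def emeasure_density)
  also have "\<dots> = 1"
    using suminf_ennreal_eq[OF p_nonneg p_sums] by (simp add: nn_integral_count_space_nat)
  finally show "emeasure letter_measure (space letter_measure) = 1" .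
qed

sublocale product_prob_space "\<lambda>_. letter_measure" UNIV
  by (intro product_prob_spaceI prob_space_P0)

lemma B_def: "B = PiM UNIV (\<lambda>_. letter_measure)" by (simp add: bernoulli_measure_def)

lemma prob_space_B: "prob_space B" unfolding B_def by (rule prob_space_PiM) (rule prob_space_P0)

sublocale B: prob_space B by (rule prob_space_B)

lemma space_B[simp]: "space B = UNIV"
  by (auto simp: B_def space_PiM point_measure_def)

lemma coord_measurable[measurable]: "(\<lambda>\<omega>. \<omega> i) \<in> B \<rightarrow>\<^sub>M count_space UNIV"
proof -
  have "(\<lambda>\<omega>. \<omega> i) \<in> B \<rightarrow>\<^sub>M letter_measure" unfolding B_def by measurable
  then show ?thesis by (simp only: measurable_cong_sets[OF refl sets_P0])
qed

lemma measurable_into_B: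
  assumes "\<And>i. (\<lambda>x. f x i) \<in> N \<rightarrow>\<^sub>M count_space UNIV"
  shows "f \<in> N \<rightarrow>\<^sub>M B"
  unfolding B_def
proof (rule measurable_PiM_single')
  show "(\<lambda>x. f x i) \<in> N \<rightarrow>\<^sub>M letter_measure" for i
    using assms[of i] by (simp only: measurable_cong_sets[OF refl sets_P0])
  show "f \<in> space N \<rightarrow> UNIV \<rightarrow>\<^sub>E space letter_measure" by (auto simp: point_measure_def)
qed

lemma shift_measurable[measurable]: "shift k \<in> B \<rightarrow>\<^sub>M B"
  by (rule measurable_into_B) simp

lemma distr_shift: "distr B B (shift k) = B"
  using distr_PiM_reindex[of UNIV "\<lambda>_. letter_measure" "\<lambda>i. i + k" UNIV] prob_space_P0
  by (simp add: B_def restrict_def)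

lemma prefix_measurable[measurable]: "prefix n \<in> B \<rightarrow>\<^sub>M count_space UNIV"
proof (subst measurable_count_space_eq2_countable, simp_all, intro allI)
  fix w :: "nat list"
  have *: "prefix n -` {w} \<inter> space B = {\<omega> \<in> space B. length w = n \<and> (\<forall>i<n. \<omega> i = w ! i)}"
    by (auto simp: prefix_eq_iff)
  also have "\<dots> \<in> sets B" by measurable
  finally show "prefix n -` {w} \<in> sets B" by simp
qed

abbreviation "wmass \<equiv> word_mass p"

lemma wmass_nonneg: "0 \<le> wmass w"
  unfolding word_mass_def by (rule prod_list_nonneg) (auto simp: p_nonneg)

lemma wmass_append: "wmass (u @ v) = wmass u * wmass v"
  by (simp add: word_mass_def)

lemma p_le_1: "p i \<le> 1"
  using p_sums p_nonneg sum_le_suminf[of p "{i}"] by (auto simp: sums_iff)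

lemma emeasure_cylinder: "length w = n \<Longrightarrow> emeasure B {\<omega>. prefix n \<omega> = w} = ennreal (wmass w)"
proof -
  assume w: "length w = n"
  have "{\<omega>. prefix n \<omega> = w} = prod_emb UNIV (\<lambda>_. letter_measure) {..<n} (\<Pi>\<^sub>E i\<in>{..<n}. {w ! i})"
    using w by (auto simp: prod_emb_def PiE_def prefix_eq_iff Pi_iff point_measure_def)
  then have "emeasure B {\<omega>. prefix n \<omega> = w} = (\<Prod>i<n. emeasure letter_measure {w ! i})"
    unfolding B_def by (simp add: emeasure_PiM_emb sets_P0)
  also have "\<dots> = (\<Prod>i<n. ennreal (p (w ! i)))"
    by (simp add: emeasure_point_measure_finite2)
  also have "\<dots> = ennreal (\<Prod>i<n. p (w ! i))"
    by (rule prod_ennreal) (simp add: p_nonneg)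
  also have "(\<Prod>i<n. p (w ! i)) = wmass w"
    using w by (simp add: word_mass_def prod.list_conv_set_nth atLeast0LessThan)
  finally show ?thesis .
qed

lemma AE_positive: "AE \<omega> in B. \<forall>i. 0 < p (\<omega> i)"
proof -
  have "AE k in letter_measure. 0 < p k"
    unfolding point_measure_def by (subst AE_density) (auto simp: AE_count_space)
  then have "AE \<omega> in B. 0 < p (\<omega> i)" for i
    unfolding B_def using AE_PiM_component[of UNIV "\<lambda>_. letter_measure" i "\<lambda>k. 0 < p k"] prob_space_P0 by simp
  then show ?thesis by (simp add: AE_all_countable)
qed

text \<open>An event invariant under \<open>shift k\<close> depends only on the coordinates from \<open>n * k\<close> on, for every
  \<open>n\<close>; so it is a tail event and Kolmogorov's zero-one law applies.\<close>

lemma shift_invariant_trivial: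
  assumes A: "A \<in> sets B" and k: "k \<ge> 1" and inv: "\<And>\<omega>. shift k \<omega> \<in> A \<longleftrightarrow> \<omega> \<in> A"
  shows "B.prob A = 0 \<or> B.prob A = 1"
proof -
  define F where "F i = {(\<lambda>\<omega>. \<omega> i) -` X \<inter> space B | X. X \<in> sets letter_measure}" for i :: nat
  have ind: "B.indep_vars (\<lambda>_. letter_measure) (\<lambda>i \<omega>. \<omega> i) UNIV"
    by (subst B.indep_vars_iff_distr_eq_PiM')
      (auto simp: B_def distr_PiM_component[of UNIV "\<lambda>_. letter_measure"] prob_space_P0 restrict_def distr_id2)
  show ?thesis
  proof (rule B.kolmogorov_0_1_law)
    show "sigma_algebra (space B) (F i)" for i
      using sets.sigma_algebra_axioms[of "vimage_algebra (space B) (\<lambda>\<omega>. \<omega> i) letter_measure"]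
        sets_vimage_algebra2[of "\<lambda>\<omega>. \<omega> i" "space B" letter_measure]
      by (simp add: F_def space_P0)
    show "B.indep_sets F UNIV"
      using ind unfolding B.indep_vars_def2 F_def by simp
    show "A \<in> B.tail_events F"
      unfolding B.tail_events_def
    proof
      fix n
      define N where "N = sigma (space B) (\<Union> (F ` {n..}))"
      have sub: "\<Union> (F ` {n..}) \<subseteq> Pow (space B)" by (auto simp: F_def)
      have "(\<lambda>\<omega>. \<omega> (i + n * k)) \<in> N \<rightarrow>\<^sub>M count_space UNIV" for i
      proof (rule measurableI)
        fix X :: "nat set"
        have "n \<le> i + n * k" using k by (cases k) auto
        moreover have "(\<lambda>\<omega>. \<omega> (i + n * k)) -` X \<inter> space B \<in> F (i + n * k)"
          unfolding F_def by (auto simp: point_measure_def)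
        ultimately show "(\<lambda>\<omega>. \<omega> (i + n * k)) -` X \<inter> space N \<in> sets N"
          unfolding N_def using sub by auto
      qed auto
      then have "shift (n * k) \<in> N \<rightarrow>\<^sub>M B" by (rule measurable_into_B)
      then have "shift (n * k) -` A \<inter> space N \<in> sets N" using A by (rule measurable_sets)
      moreover have "shift (n * k) \<omega> \<in> A \<longleftrightarrow> \<omega> \<in> A" for \<omega>
      proof (induction n arbitrary: \<omega>)
        case (Suc n)
        show ?case using Suc[of "shift k \<omega>"] inv[of \<omega>] by (simp add: add.assoc add.commute[of k])
      qed simp
      ultimately have "A \<in> sets N"
        by (simp add: vimage_def N_def space_measure_of_conv)
      then show "A \<in> sigma_sets (space B) (\<Union> (F ` {n..}))"
        unfolding N_def using sub by simp
    qed
  qed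
qed

text \<open>The set of sequences with unbounded sums is invariant, hence has probability 0 or 1. Probability 1
  would make the mean of \<open>f\<close> nonnegative by the maximal ergodic theorem. This lemma replaces the strong law
  of large numbers everywhere below: adding a small constant to \<open>f\<close> turns boundedness of the sums
  into a linear rate.\<close>

lemma block_sums_bounded:
  fixes f :: "(nat \<Rightarrow> nat) \<Rightarrow> real"
  assumes f: "integrable B f" and neg: "(\<integral>\<omega>. f \<omega> \<partial>B) < 0" and k: "k \<ge> 1"
  shows "AE \<omega> in B. \<exists>K. \<forall>n. (\<Sum>j<n. f (shift (j * k) \<omega>)) \<le> K"
proof -
  have iter: "(shift k ^^ j) \<omega> = shift (j * k) \<omega>" for j \<omega>
    by (induction j arbitrary: \<omega>) (auto simp: funpow_swap1 add.assoc add.commute[of k])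
  define A where "A = {\<omega> \<in> space B. \<not> (\<exists>K. \<forall>n. (\<Sum>j<n. f ((shift k ^^ j) \<omega>)) \<le> K)}"
  note * = maximal_ergodic_nonneg[where M = B and \<theta> = "shift k",
      OF prob_space_B shift_measurable distr_shift f, folded A_def]
  have "B.prob A = 0 \<or> B.prob A = 1"
    using * by (intro shift_invariant_trivial[OF _ k]) auto
  moreover have "B.prob A \<noteq> 1"
  proof
    assume "B.prob A = 1"
    then have "AE \<omega> in B. \<omega> \<in> A" using *(1) by (simp add: B.prob_eq_1)
    then have "(\<integral>\<omega>. indicator A \<omega> * f \<omega> \<partial>B) = (\<integral>\<omega>. f \<omega> \<partial>B)"
      using f *(1) by (intro integral_cong_AE) auto
    then show False using *(3) neg by simp
  qed
  ultimately have "AE \<omega> in B. \<omega> \<notin> A"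
    using *(1) by (simp add: AE_iff_measurable[of A] B.emeasure_eq_measure)
  then show ?thesis by eventually_elim (auto simp: A_def iter)
qed

lemma prefix_measurable_words: "prefix k \<in> B \<rightarrow>\<^sub>M count_space (words k)"
  using measurable_sets[OF prefix_measurable[of k]]
  by (subst measurable_count_space_eq2_countable) auto

lemma distr_prefix:
  "distr B (count_space (words k)) (prefix k)
    = density (count_space (words k)) (\<lambda>w. ennreal (wmass w))"
proof (rule measure_eqI_countable)
  note m = prefix_measurable_words[of k]
  show "countable (words k)" by (rule countable_subset[OF subset_UNIV]) auto
  fix w :: "nat list" assume w: "w \<in> (words k)"
  have "emeasure (distr B (count_space (words k)) (prefix k)) {w} = emeasure B {\<omega>. prefix k \<omega> = w}"
    using w by (subst emeasure_distr[OF m]) (auto simp: vimage_def)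
  also have "\<dots> = ennreal (wmass w)" using w by (intro emeasure_cylinder) simp
  also have "\<dots> = emeasure (density (count_space (words k)) (\<lambda>w. ennreal (wmass w))) {w}"
    using w by (simp add: emeasure_density nn_integral_indicator_singleton' nn_integral_count_space_indicator)
  finally show "emeasure (distr B (count_space (words k)) (prefix k)) {w} = \<dots>" .
qed auto


lemma nn_integral_prefix:
  "(\<integral>\<^sup>+\<omega>. g (prefix k \<omega>) \<partial>B) = (\<integral>\<^sup>+w. ennreal (wmass w) * g w \<partial>count_space (words k))"
proof -
  have "(\<integral>\<^sup>+\<omega>. g (prefix k \<omega>) \<partial>B) = (\<integral>\<^sup>+w. g w \<partial>distr B (count_space (words k)) (prefix k))"
    by (rule nn_integral_distr[symmetric]) (auto intro: prefix_measurable_words)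
  also have "\<dots> = (\<integral>\<^sup>+w. ennreal (wmass w) * g w \<partial>count_space (words k))"
    unfolding distr_prefix by (rule nn_integral_density) auto
  finally show ?thesis .
qed

lemma integrable_prefix_iff:
  fixes g :: "nat list \<Rightarrow> real"
  shows "integrable B (\<lambda>\<omega>. g (prefix k \<omega>)) \<longleftrightarrow> integrable (count_space (words k)) (\<lambda>w. wmass w * g w)"
proof -
  have "integrable B (\<lambda>\<omega>. g (prefix k \<omega>)) \<longleftrightarrow> integrable (distr B (count_space (words k)) (prefix k)) g"
    by (rule integrable_distr_eq[symmetric]) (auto intro: prefix_measurable_words)
  also have "\<dots> \<longleftrightarrow> integrable (count_space (words k)) (\<lambda>w. wmass w * g w)"
    unfolding distr_prefix by (subst integrable_density) (auto simp: wmass_nonneg)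
  finally show ?thesis .
qed

lemma integral_prefix:
  fixes g :: "nat list \<Rightarrow> real"
  shows "(\<integral>\<omega>. g (prefix k \<omega>) \<partial>B) = (\<integral>w. wmass w * g w \<partial>count_space (words k))"
proof -
  have "(\<integral>\<omega>. g (prefix k \<omega>) \<partial>B) = integral\<^sup>L (distr B (count_space (words k)) (prefix k)) g"
    by (rule integral_distr[symmetric]) (auto intro: prefix_measurable_words)
  also have "\<dots> = (\<integral>w. wmass w * g w \<partial>count_space (words k))"
    unfolding distr_prefix by (subst integral_density) (auto simp: wmass_nonneg)
  finally show ?thesis .
qed

lemma integrable_wmass: "integrable (count_space (words k)) wmass"
  and integral_wmass: "(\<integral>w. wmass w \<partial>count_space (words k)) = 1"
  using integrable_prefix_iff[of "\<lambda>_. 1" k] integral_prefix[of "\<lambda>_. 1" k] by (simp_all add: B.prob_space[simplified])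

lemma ln_wmass_prefix:
  assumes "\<And>i. 0 < p (\<omega> i)"
  shows "0 < wmass (prefix n \<omega>)"
    and "ln (wmass (prefix (n * k) \<omega>)) = (\<Sum>j<n. ln (wmass (prefix k (shift (j * k) \<omega>))))"
proof -
  have pos: "0 < wmass (prefix n \<omega>)" if "\<And>i. 0 < p (\<omega> i)" for \<omega> n
    using that by (induction n) (auto simp: word_mass_def)
  show "0 < wmass (prefix n \<omega>)" by (rule pos[OF assms])
  show "ln (wmass (prefix (n * k) \<omega>)) = (\<Sum>j<n. ln (wmass (prefix k (shift (j * k) \<omega>))))"
  proof (induction n)
    case 0 then show ?case by (simp add: word_mass_def)
  next
    case (Suc n)
    have "prefix (Suc n * k) \<omega> = prefix (n * k) \<omega> @ prefix k (shift (n * k) \<omega>)"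
      unfolding prefix_block[where n = "Suc n"] prefix_block[where n = n] by simp
    moreover have "0 < wmass (prefix (n * k) \<omega>)" "0 < wmass (prefix k (shift (n * k) \<omega>))"
      using pos assms by auto
    ultimately show ?case using Suc by (simp add: wmass_append ln_mult)
  qed
qed

end

section \<open>Hausdorff dimension from coverings and from mass distributions\<close>

lemma diam_pow_nonneg: "0 \<le> diam_pow s U"
  by (simp add: diam_pow_def)

text \<open>Covers indexed by arbitrary countable sets are admissible: the remaining natural numbers are filled
  up with empty sets, which contribute nothing even when the exponent is 0.\<close>

lemma hausdorff_premeasure_le_countable_cover:
  fixes U :: "'i \<Rightarrow> 'a::metric_space set"
  assumes I: "countable I" and A: "A \<subseteq> (\<Union>i\<in>I. U i)" and \<delta>: "0 < \<delta>"
    and U: "\<And>i. i \<in> I \<Longrightarrow> bounded (U i)" "\<And>i. i \<in> I \<Longrightarrow> diameter (U i) \<le> \<delta>"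
  shows "hausdorff_premeasure s \<delta> A \<le> (\<integral>\<^sup>+i. ennreal (diam_pow s (U i)) \<partial>count_space I)"
proof -
  define R where "R = to_nat_on I ` I"
  define V where "V n = (if n \<in> R then U (from_nat_into I n) else {})" for n
  have bij: "bij_betw (to_nat_on I) I R"
    unfolding R_def by (intro inj_on_imp_bij_betw inj_on_to_nat_on I)
  have from_to: "from_nat_into I (to_nat_on I i) = i" if "i \<in> I" for i
    using I that by simp
  have mem: "from_nat_into I n \<in> I" if "n \<in> R" for n
    using that from_to by (auto simp: R_def)
  have "A \<subseteq> (\<Union>n. V n)"
  proof
    fix x assume "x \<in> A"
    then obtain i where "i \<in> I" "x \<in> U i" using A by auto
    then have "x \<in> V (to_nat_on I i)" by (auto simp: V_def R_def from_to)
    then show "x \<in> (\<Union>n. V n)" by blast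
  qed
  moreover have "bounded (V n) \<and> diameter (V n) \<le> \<delta>" for n
    using U mem \<delta> by (auto simp: V_def)
  ultimately have "hausdorff_premeasure s \<delta> A \<le> (\<Sum>n. ennreal (diam_pow s (V n)))"
    unfolding hausdorff_premeasure_def by (intro Inf_lower) blast
  also have "\<dots> = (\<integral>\<^sup>+n. ennreal (diam_pow s (V n)) \<partial>count_space UNIV)"
    by (simp add: nn_integral_count_space_nat)
  also have "\<dots> = (\<integral>\<^sup>+n. ennreal (diam_pow s (U (from_nat_into I n))) \<partial>count_space R)"
    by (subst (2) nn_integral_count_space_indicator)
      (auto intro!: nn_integral_cong simp: V_def diam_pow_def split: split_indicator)
  also have "\<dots> = (\<integral>\<^sup>+i. ennreal (diam_pow s (U (from_nat_into I (to_nat_on I i)))) \<partial>count_space I)"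
    by (rule nn_integral_bij_count_space[OF bij, symmetric])
  also have "\<dots> = (\<integral>\<^sup>+i. ennreal (diam_pow s (U i)) \<partial>count_space I)"
    by (rule nn_integral_cong) (simp add: from_to)
  finally show ?thesis .
qed

lemma hausdorff_measure_eq_0I:
  fixes A :: "'a::metric_space set"
  assumes "\<And>\<delta> e. 0 < \<delta> \<Longrightarrow> 0 < e \<Longrightarrow> \<exists>(I::'i set) U. countable I \<and> A \<subseteq> (\<Union>i\<in>I. U i) \<and>
      (\<forall>i\<in>I. bounded (U i) \<and> diameter (U i) \<le> \<delta>) \<and>
      (\<integral>\<^sup>+i. ennreal (diam_pow s (U i)) \<partial>count_space I) \<le> ennreal e"
  shows "hausdorff_measure s A = 0"
proof -
  have "hausdorff_premeasure s \<delta> A \<le> 0" if \<delta>: "0 < \<delta>" for \<delta>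
  proof (rule ennreal_le_epsilon)
    fix e :: real assume e: "0 < e"
    obtain I :: "'i set" and U where I: "countable I" "A \<subseteq> (\<Union>i\<in>I. U i)"
        "\<forall>i\<in>I. bounded (U i) \<and> diameter (U i) \<le> \<delta>"
        "(\<integral>\<^sup>+i. ennreal (diam_pow s (U i)) \<partial>count_space I) \<le> ennreal e"
      using assms[OF \<delta> e] by blast
    have "hausdorff_premeasure s \<delta> A \<le> (\<integral>\<^sup>+i. ennreal (diam_pow s (U i)) \<partial>count_space I)"
      using I(3) by (intro hausdorff_premeasure_le_countable_cover[OF I(1,2) \<delta>]) auto
    then show "hausdorff_premeasure s \<delta> A \<le> 0 + ennreal e"
      using I(4) by simp
  qed
  then show ?thesis unfolding hausdorff_measure_def by (auto simp: SUP_eq_iff)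
qed

lemma measure_dim_le:
  assumes "A \<in> sets borel" "emeasure \<mu> A = 1" "0 \<le> t" "hausdorff_measure t A = 0"
  shows "measure_dim \<mu> \<le> ereal t"
proof -
  have "measure_dim \<mu> \<le> hausdorff_dim A"
    unfolding measure_dim_def using assms by (intro INF_lower) auto
  also have "\<dots> \<le> ereal t"
    unfolding hausdorff_dim_def using assms by (intro Inf_lower) auto
  finally show ?thesis .
qed

text \<open>Mass distribution principle. A covering set \<open>U\<close> need not be measurable, and is therefore replaced by the
  interval from \<open>Inf U\<close> to \<open>Inf U + diameter U\<close>. Restricting the estimate to
  an event \<open>E\<close> of positive probability leaves room for constants that vary from point to point.\<close>

lemma measure_dim_ge:
  fixes X :: "'a \<Rightarrow> real"
  assumes M: "prob_space M" and X[measurable]: "X \<in> borel_measurable M"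
    and E[measurable]: "E \<in> sets M" and pos: "0 < emeasure M E" and K: "0 \<le> K" and t: "0 < t"
    and mass: "\<And>c d. 0 \<le> d \<Longrightarrow> d \<le> 1 \<Longrightarrow>
      emeasure M {x \<in> E. X x \<in> {c..c + d}} \<le> ennreal (K * d powr t)"
  shows "ereal t \<le> measure_dim (distr M borel X)"
  unfolding measure_dim_def
proof (rule INF_greatest)
  interpret prob_space M by fact
  fix A assume "A \<in> {A \<in> sets borel. emeasure (distr M borel X) A = 1}"
  then have A[measurable]: "A \<in> sets borel" and A1: "emeasure M (X -` A \<inter> space M) = 1"
    by (auto simp: emeasure_distr)
  have AE_A: "AE x in M. X x \<in> A"
    using A1 AE_in_set_eq_1[of "X -` A \<inter> space M"] by (auto simp: emeasure_eq_measure)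
  show "ereal t \<le> hausdorff_dim A"
    unfolding hausdorff_dim_def
  proof (rule Inf_greatest, clarify, rule ccontr)
    fix s assume s: "0 \<le> s" "hausdorff_measure s A = 0" "\<not> ereal t \<le> ereal s"
    have "hausdorff_premeasure s 1 A \<le> hausdorff_measure s A"
      unfolding hausdorff_measure_def by (rule SUP_upper) simp
    then have pre0: "hausdorff_premeasure s 1 A = 0" using s by simp
    have "emeasure M E \<le> 0"
    proof (rule ennreal_le_epsilon)
      fix e :: real assume e: "0 < e"
      have "hausdorff_premeasure s 1 A < ennreal (e / (K + 1))"
        using pre0 e K by (auto simp: ennreal_zero_less_divide ennreal_less_zero_iff)
      then obtain U :: "nat \<Rightarrow> real set" where U: "A \<subseteq> (\<Union>i. U i)"
          "\<And>i. bounded (U i)" "\<And>i. diameter (U i) \<le> 1"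
        and sum: "(\<Sum>i. ennreal (diam_pow s (U i))) < ennreal (e / (K + 1))"
        unfolding hausdorff_premeasure_def Inf_less_iff by auto
      (* the constant K + 1 in the bounds below keeps the division by it legitimate when K = 0 *)
      define V where "V i = {x \<in> E. U i \<noteq> {} \<and> X x \<in> {Inf (U i)..Inf (U i) + diameter (U i)}}" for i
      have V[measurable]: "V i \<in> sets M" for i
        using sets.sets_into_space[OF E] unfolding V_def by (cases "U i = {}") auto
      have V_mass: "emeasure M (V i) \<le> ennreal (K + 1) * ennreal (diam_pow s (U i))" for i
      proof (cases "U i = {}")
        case False
        have d: "0 \<le> diameter (U i)" "diameter (U i) \<le> 1"
          using U(3) by (auto intro: diameter_ge_0[OF U(2)])
        have "diameter (U i) powr t \<le> diam_pow s (U i)"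
          using False d s by (auto simp: diam_pow_def powr_le_one_le intro: powr_mono' powr_le1)
        then have "K * diameter (U i) powr t \<le> (K + 1) * diam_pow s (U i)"
          using K by (intro mult_mono) auto
        have "V i = {x \<in> E. X x \<in> {Inf (U i)..Inf (U i) + diameter (U i)}}"
          using False by (simp add: V_def)
        then have "emeasure M (V i) \<le> ennreal (K * diameter (U i) powr t)"
          using mass[OF d, of "Inf (U i)"] by simp
        also have "\<dots> \<le> ennreal ((K + 1) * diam_pow s (U i))"
          by (rule ennreal_leI) fact
        also have "\<dots> = ennreal (K + 1) * ennreal (diam_pow s (U i))"
          using K by (simp add: ennreal_mult diam_pow_nonneg del: ennreal_plus)
        finally show ?thesis .
      qed (simp add: V_def)
      have U_sub: "X x \<in> {Inf (U i)..Inf (U i) + diameter (U i)}" if "X x \<in> U i" for x i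
      proof -
        have "bdd_below (U i)" by (rule bounded_imp_bdd_below[OF U(2)])
        then have "Inf (U i) \<le> X x" using that by (intro cInf_lower) auto
        moreover have "X x - diameter (U i) \<le> Inf (U i)"
        proof (rule cInf_greatest)
          fix y assume "y \<in> U i"
          then have "dist (X x) y \<le> diameter (U i)"
            using diameter_bounded_bound[OF U(2) that] by simp
          then show "X x - diameter (U i) \<le> y" by (simp add: dist_real_def abs_le_iff)
        qed (use that in auto)
        ultimately show ?thesis by simp
      qed
      have "AE x in M. x \<in> E \<longrightarrow> x \<in> (\<Union>i. V i)"
        using AE_A
      proof (eventually_elim, intro impI)
        fix x assume "X x \<in> A" "x \<in> E"
        then obtain i where i: "X x \<in> U i" using U(1) by blast
        then have "x \<in> V i" using U_sub[OF i] \<open>x \<in> E\<close> unfolding V_def by blast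
        then show "x \<in> (\<Union>i. V i)" by blast
      qed
      then have "emeasure M E \<le> emeasure M (\<Union>i. V i)"
        by (intro emeasure_mono_AE) auto
      also have "\<dots> \<le> (\<Sum>i. emeasure M (V i))"
        by (intro emeasure_subadditive_countably) auto
      also have "\<dots> \<le> (\<Sum>i. ennreal (K + 1) * ennreal (diam_pow s (U i)))"
        by (intro suminf_le V_mass) auto
      also have "\<dots> = ennreal (K + 1) * (\<Sum>i. ennreal (diam_pow s (U i)))"
        by simp
      also have "\<dots> \<le> ennreal (K + 1) * ennreal (e / (K + 1))"
        using sum by (intro mult_left_mono) auto
      also have "\<dots> = ennreal e" using K e by (simp add: ennreal_mult[symmetric] del: ennreal_plus)
      finally show "emeasure M E \<le> 0 + ennreal e" by simp
    qed
    then show False using pos by simp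
  qed
qed

section \<open>Cylinder systems with bounded distortion\<close>

text \<open>The part of the geometry that the dimension theory uses. Up to the factor \<open>C\<close>, the length of a
  cylinder is a multiplicative function of its word, so on blocks its logarithm is a sum of i.i.d.
  terms with an error of at most \<open>ln C\<close> per block; long blocks make this error negligible.\<close>

locale cylinder_system =
  fixes J :: "nat list \<Rightarrow> real set" and C C0 \<rho> :: real
  assumes J_convex: "convex (J w)" and J_bounded: "bounded (J w)"
    and J_disjoint: "length u = length v \<Longrightarrow> u \<noteq> v \<Longrightarrow> J u \<inter> J v = {}"
    and J_append: "J (u @ v) \<subseteq> J u"
    and J_pos: "0 < diameter (J w)" and J_Nil: "diameter (J []) = 1"
    and C_ge_1: "1 \<le> C"
    and L_append_le: "diameter (J (u @ v)) \<le> C * (diameter (J u) * diameter (J v))"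
    and L_append_ge: "diameter (J u) * diameter (J v) \<le> C * diameter (J (u @ v))"
    and \<rho>: "0 < \<rho>" "\<rho> < 1" and C0: "0 < C0"
    and L_decay: "diameter (J w) \<le> C0 * \<rho> ^ length w"
begin

abbreviation L :: "nat list \<Rightarrow> real" where "L w \<equiv> diameter (J w)"

definition code :: "(nat \<Rightarrow> nat) \<Rightarrow> real" where
  "code \<omega> = (THE x. x \<in> (\<Inter>n\<in>{1..}. closure (J (prefix n \<omega>))))"

lemma J_nonempty: "J w \<noteq> {}" using J_pos[of w] by auto

lemma L_le_1: "L w \<le> 1"
  using diameter_subset[OF J_append[of "[]" w] J_bounded] J_Nil by simp

lemma prefix_mono: "m \<le> n \<Longrightarrow> J (prefix n \<omega>) \<subseteq> J (prefix m \<omega>)"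
proof -
  assume "m \<le> n"
  then have "prefix n \<omega> = prefix m \<omega> @ map \<omega> [m..<n]"
    using upt_add_eq_append[of 0 m "n - m"] by simp
  then show ?thesis by (simp add: J_append)
qed

lemma L_prefix_tendsto: "(\<lambda>n. L (prefix n \<omega>)) \<longlonglongrightarrow> 0"
proof (rule tendsto_sandwich)
  show "\<forall>\<^sub>F n in sequentially. 0 \<le> L (prefix n \<omega>)"
    using J_pos by (simp add: less_imp_le)
  show "\<forall>\<^sub>F n in sequentially. L (prefix n \<omega>) \<le> C0 * \<rho> ^ n"
    using L_decay[of "prefix _ \<omega>"] by simp
  show "(\<lambda>n. C0 * \<rho> ^ n) \<longlonglongrightarrow> 0"
    using \<rho> by (intro tendsto_mult_right_zero LIMSEQ_power_zero) auto
qed simp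

lemma closure_J_dist: "x \<in> closure (J w) \<Longrightarrow> y \<in> closure (J w) \<Longrightarrow> \<bar>x - y\<bar> \<le> L w"
  using diameter_bounded_bound[of "closure (J w)" x y] J_bounded[of w]
  by (simp add: diameter_closure dist_real_def bounded_closure)

lemma code_mem: "code \<omega> \<in> closure (J (prefix n \<omega>))"
proof -
  have "(\<Inter>n. closure (J (prefix n \<omega>))) \<noteq> {}"
    using compact_nest[of "\<lambda>n. closure (J (prefix n \<omega>))"] J_bounded J_nonempty prefix_mono
    by (auto simp: closure_mono)
  then obtain x where x: "\<And>n. x \<in> closure (J (prefix n \<omega>))" by auto
  have "code \<omega> = x" unfolding code_def
  proof (rule the_equality)
    fix y assume y: "y \<in> (\<Inter>n\<in>{1..}. closure (J (prefix n \<omega>)))"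
    have "\<bar>y - x\<bar> \<le> 0"
    proof (rule LIMSEQ_le_const[OF L_prefix_tendsto], intro exI allI impI)
      fix n :: nat assume "1 \<le> n"
      then show "\<bar>y - x\<bar> \<le> L (prefix n \<omega>)" using x y by (intro closure_J_dist) auto
    qed
    then show "y = x" by simp
  qed (use x in auto)
  then show ?thesis using x by simp
qed

lemma L_prefix_blocks:
  shows "ln (L (prefix (n * k) \<omega>)) \<le> (\<Sum>j<n. ln (C * L (prefix k (shift (j * k) \<omega>))))"
    and "(\<Sum>j<n. ln (L (prefix k (shift (j * k) \<omega>))) - ln C) \<le> ln (L (prefix (n * k) \<omega>))"
proof (induction n)
  case 0
  {
    case 1 show ?case by (simp add: J_Nil)
  next
    case 2 show ?case by (simp add: J_Nil)
  }
next
  case (Suc n)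
  let ?u = "prefix (n * k) \<omega>" and ?v = "prefix k (shift (n * k) \<omega>)"
  have split: "prefix (Suc n * k) \<omega> = ?u @ ?v"
    unfolding prefix_block[where n = "Suc n"] prefix_block[where n = n] by simp
  have pos: "0 < L ?u" "0 < L ?v" "0 < L (?u @ ?v)" "0 < C" using J_pos C_ge_1 by auto
  {
    case 1
    have "ln (L (?u @ ?v)) \<le> ln (C * (L ?u * L ?v))"
      using L_append_le pos by (subst ln_le_cancel_iff) auto
    also have "\<dots> = ln (L ?u) + ln (C * L ?v)"
      using pos by (simp add: ln_mult)
    finally show ?case using Suc(1) unfolding split by simp
  next
    case 2
    have "ln (L ?u * L ?v) \<le> ln (C * L (?u @ ?v))"
      using L_append_ge pos by (subst ln_le_cancel_iff) auto
    then have "ln (L ?u) + ln (L ?v) \<le> ln C + ln (L (?u @ ?v))"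
      using pos by (simp add: ln_mult)
    then show ?case using Suc(2) unfolding split by simp
  }
qed

text \<open>The coding map is the pointwise limit of the left end points of the cylinders, each of which
  depends on finitely many symbols.\<close>

lemma code_measurable:
  assumes "prob_vector p"
  shows "code \<in> borel_measurable (bernoulli_measure p)"
proof -
  interpret bernoulli p by unfold_locales fact
  show ?thesis
  proof (rule borel_measurable_LIMSEQ_real)
    show "(\<lambda>\<omega>. Inf (J (prefix n \<omega>))) \<in> borel_measurable B" for n
      by (rule measurable_compose[OF prefix_measurable]) simp
    fix \<omega>
    show "(\<lambda>n. Inf (J (prefix n \<omega>))) \<longlonglongrightarrow> code \<omega>"
    proof (rule LIM_zero_cancel, rule Lim_null_comparison[OF _ L_prefix_tendsto], rule always_eventually, rule allI)
      fix n
      have "Inf (J (prefix n \<omega>)) \<in> closure (J (prefix n \<omega>))"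
        using J_nonempty J_bounded by (intro closure_contains_Inf) (auto simp: bounded_imp_bdd_below)
      then show "norm (Inf (J (prefix n \<omega>)) - code \<omega>) \<le> L (prefix n \<omega>)"
        using closure_J_dist[OF _ code_mem] by simp
    qed
  qed
qed

text \<open>By hypothesis, almost every sequence has arbitrarily long prefixes \<open>w\<close>, of length \<open>n * k\<close>, with
  \<open>L w powr t \<le> exp (- n \<epsilon>) * word_mass p w\<close>. For each \<open>N\<close>, the cylinders of this kind at the levels
  \<open>n \<ge> N\<close> cover a fixed set of full measure, and since the masses at one level add up to 1, the sum
  of their \<open>t\<close>-th powers is at most a tail of the geometric series.\<close>

lemma measure_dim_code_le:
  assumes p: "prob_vector p" and t: "0 < t" and k: "k \<ge> 1" and \<epsilon>: "0 < \<epsilon>"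
    and ev: "AE \<omega> in bernoulli_measure p. \<forall>\<^sub>F n in sequentially.
      L (prefix (n * k) \<omega>) powr t \<le> exp (- (real n * \<epsilon>)) * word_mass p (prefix (n * k) \<omega>)"
  shows "measure_dim (distr (bernoulli_measure p) borel code) \<le> ereal t"
proof -
  interpret bernoulli p by unfold_locales fact
  define W where "W n = {w. length w = n * k \<and> L w powr t \<le> exp (- (real n * \<epsilon>)) * wmass w}" for n
  define A where "A = (\<Inter>N. \<Union>n\<in>{N..}. \<Union>w\<in>W n. closure (J w))"
  have [measurable]: "code \<in> borel_measurable B" by (rule code_measurable[OF p])
  have A[measurable]: "A \<in> sets borel" unfolding A_def by measurable
  have "AE \<omega> in B. code \<omega> \<in> A"
    using ev
  proof eventually_elim
    case (elim \<omega>)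
    show "code \<omega> \<in> A" unfolding A_def
    proof (intro INT_I)
      fix N :: nat
      obtain n where "n \<ge> N" "L (prefix (n * k) \<omega>) powr t \<le> exp (- (real n * \<epsilon>)) * wmass (prefix (n * k) \<omega>)"
        using elim unfolding eventually_sequentially by (meson nle_le)
      then have "n \<in> {N..}" "prefix (n * k) \<omega> \<in> W n" by (auto simp: W_def)
      then show "code \<omega> \<in> (\<Union>n\<in>{N..}. \<Union>w\<in>W n. closure (J w))"
        using code_mem[of \<omega> "n * k"] by blast
    qed
  qed
  then have "emeasure (distr B borel code) A = 1"
    using measurable_sets[of code B borel A]
    by (subst emeasure_distr) (auto intro!: B.emeasure_eq_1_AE)
  moreover have "hausdorff_measure t A = 0"
  proof (rule hausdorff_measure_eq_0I)
    fix \<delta> e :: real assume \<delta>: "0 < \<delta>" and e: "0 < e"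
    (* q squared is the given rate: one factor becomes small with N, the other one sums up *)
    define q where "q = exp (- (\<epsilon> / 2))"
    have q: "0 < q" "q < 1" using \<epsilon> by (auto simp: q_def)
    have q_pow: "exp (- (real n * \<epsilon>)) = q ^ n * q ^ n" for n
      by (simp add: q_def exp_of_nat_mult[symmetric] mult_exp_exp)
    define S where "S = (\<Sum>n. q ^ n)"
    have "(\<lambda>n. q ^ n * S) \<longlonglongrightarrow> 0"
      using q by (intro tendsto_mult_left_zero LIMSEQ_power_zero) auto
    moreover have "(\<lambda>n. C0 * \<rho> ^ n) \<longlonglongrightarrow> 0"
      using \<rho> by (intro tendsto_mult_right_zero LIMSEQ_power_zero) auto
    ultimately have "\<forall>\<^sub>F n in sequentially. q ^ n * S < e \<and> C0 * \<rho> ^ n < \<delta>"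
      using e \<delta> by (auto intro!: eventually_conj order_tendstoD(2))
    then obtain N where N: "q ^ N * S < e" "C0 * \<rho> ^ N < \<delta>"
      unfolding eventually_sequentially by blast
    define I where "I = Sigma {N..} W"
    have "A \<subseteq> (\<Union>i\<in>I. closure (J (snd i)))"
      unfolding A_def I_def by fastforce
    moreover have "bounded (closure (J (snd i))) \<and> diameter (closure (J (snd i))) \<le> \<delta>" if "i \<in> I" for i
    proof -
      obtain n w where i: "i = (n, w)" "n \<ge> N" "length w = n * k" using \<open>i \<in> I\<close> by (auto simp: I_def W_def)
      have "N \<le> n * k" using i k by (metis mult.right_neutral mult_le_mono)
      then have "C0 * \<rho> ^ (n * k) \<le> C0 * \<rho> ^ N"
        using \<rho> C0 by (intro mult_left_mono power_decreasing) auto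
      then have "L w \<le> \<delta>" using L_decay[of w] i N by simp
      then show ?thesis using i J_bounded by (auto simp: diameter_closure)
    qed
    moreover have "(\<integral>\<^sup>+i. ennreal (diam_pow t (closure (J (snd i)))) \<partial>count_space I) \<le> ennreal e"
    proof -
      let ?h = "\<lambda>(n, w). ennreal (q ^ N * q ^ n) * (ennreal (wmass w) * indicator (words (n * k)) w)"
      have "(\<integral>\<^sup>+i. ennreal (diam_pow t (closure (J (snd i)))) \<partial>count_space I)
          = (\<integral>\<^sup>+i. ennreal (diam_pow t (closure (J (snd i)))) * indicator I i \<partial>count_space UNIV)"
        by (rule nn_integral_count_space_indicator) simp
      also have "\<dots> \<le> (\<integral>\<^sup>+i. ?h i \<partial>count_space UNIV)"
      proof (intro nn_integral_mono)
        fix i :: "nat \<times> nat list"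
        obtain n w where i: "i = (n, w)" by (cases i)
        show "ennreal (diam_pow t (closure (J (snd i)))) * indicator I i \<le> ?h i"
        proof (cases "i \<in> I")
          case True
          then have w: "n \<ge> N" "length w = n * k" "L w powr t \<le> q ^ n * q ^ n * wmass w"
            by (auto simp: i I_def W_def q_pow)
          have "q ^ n \<le> q ^ N" using w q by (intro power_decreasing) auto
          then have "q ^ n * q ^ n * wmass w \<le> q ^ N * q ^ n * wmass w"
            using q by (intro mult_right_mono wmass_nonneg) auto
          then have "diam_pow t (closure (J w)) \<le> q ^ N * q ^ n * wmass w"
            using w t J_nonempty[of w] by (simp add: diam_pow_def diameter_closure J_bounded)
          then show ?thesis using True w q
            by (simp add: i ennreal_mult[symmetric] wmass_nonneg mult.assoc[symmetric] ennreal_leI)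
        qed simp
      qed
      also have "\<dots> = (\<integral>\<^sup>+n. \<integral>\<^sup>+w. ?h (n, w) \<partial>count_space UNIV \<partial>count_space UNIV)"
        by (rule nn_integral_fst_count_space[symmetric])
      also have "\<dots> = (\<integral>\<^sup>+n. ennreal (q ^ N * q ^ n) \<partial>count_space UNIV)"
      proof (rule nn_integral_cong)
        fix n
        have "(\<integral>\<^sup>+w. ennreal (wmass w) * indicator (words (n * k)) w \<partial>count_space UNIV) = 1"
          using nn_integral_prefix[of "\<lambda>_. 1" "n * k"] B.emeasure_space_1
          by (subst nn_integral_count_space_indicator[symmetric]) auto
        then show "(\<integral>\<^sup>+w. ?h (n, w) \<partial>count_space UNIV) = ennreal (q ^ N * q ^ n)"
          by (simp add: nn_integral_cmult)
      qed
      also have "\<dots> = ennreal (q ^ N * S)"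
        unfolding S_def using q
        by (simp add: nn_integral_count_space_nat suminf_ennreal2 summable_mult summable_geometric suminf_mult)
      also have "\<dots> \<le> ennreal e" using N by (simp add: ennreal_leI)
      finally show ?thesis .
    qed
    ultimately show "\<exists>(I::(nat \<times> nat list) set) U. countable I \<and> A \<subseteq> (\<Union>i\<in>I. U i) \<and>
      (\<forall>i\<in>I. bounded (U i) \<and> diameter (U i) \<le> \<delta>) \<and>
      (\<integral>\<^sup>+i. ennreal (diam_pow t (U i)) \<partial>count_space I) \<le> ennreal e"
      by (intro exI[of _ I] exI[of _ "\<lambda>i. closure (J (snd i))"]) auto
  qed
  ultimately show ?thesis using t A by (intro measure_dim_le) auto
qed

end

section \<open>Entropy against contraction on words of fixed length\<close>

lemma tendsto_x_ln_x:
  fixes y :: "nat \<Rightarrow> real"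
  assumes y: "y \<longlonglongrightarrow> l" and nonneg: "\<And>n. 0 \<le> y n"
  shows "(\<lambda>n. y n * ln (y n)) \<longlonglongrightarrow> l * ln l"
proof (cases "l = 0")
  case False
  then show ?thesis using y by (intro tendsto_intros) auto
next
  case True
  have "((\<lambda>x::real. x * ln x) \<longlongrightarrow> 0) (at_right 0)" by real_asymp
  then have "((\<lambda>x::real. x * ln x) \<longlongrightarrow> 0 * ln 0) (at 0 within {0..})"
    by (simp add: at_within_Ici_at_right)
  then have "continuous (at 0 within {0..}) (\<lambda>x::real. x * ln x)"
    by (simp add: continuous_within)
  then show ?thesis
    using continuous_within_tendsto_compose'[of 0 "{0..}" "\<lambda>x::real. x * ln x" y sequentially] y nonneg True
    by simp
qed

lemma word_mass_tendsto:
  "(\<And>i. (\<lambda>n. q n i) \<longlonglongrightarrow> p i) \<Longrightarrow> (\<lambda>n. word_mass (q n) w) \<longlonglongrightarrow> word_mass p w"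
  by (induction w) (auto simp: word_mass_def intro: tendsto_mult)

context cylinder_system
begin

text \<open>The weights \<open>L [i] powr t\<close>, normalized, form a probability vector \<open>q\<close>. By submultiplicativity
  \<open>L w powr t\<close> is at most a constant times \<open>word_mass q w\<close>, and the masses of the words
  of a given length sum to 1.\<close>

lemma L_powr_integrable:
  assumes t: "0 < t" and sm: "summable (\<lambda>i. L [i] powr t)"
  shows "integrable (count_space (words k)) (\<lambda>w. L w powr t)"
proof -
  define Z where "Z = (\<Sum>i. L [i] powr t)"
  have Lpos: "0 < L w powr t" for w using J_pos[of w] by simp
  have Z: "0 < Z" unfolding Z_def by (rule suminf_pos[OF sm]) (use Lpos in auto)
  define q where "q i = L [i] powr t / Z" for i
  have "prob_vector q"
    unfolding prob_vector_def q_def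
    using sums_divide[OF summable_sums[OF sm], of Z] Z by (simp add: Z_def[symmetric])
  then interpret bernoulli q by unfold_locales
  have bound: "L w powr t \<le> (C powr t * Z) ^ length w * wmass w" for w
  proof (induction w)
    case Nil show ?case by (simp add: J_Nil word_mass_def)
  next
    case (Cons i w)
    have "L (i # w) powr t \<le> (C * (L [i] * L w)) powr t"
      using L_append_le[of "[i]" w] J_pos[of "i # w"] t by (intro powr_mono2) auto
    also have "\<dots> = C powr t * Z * q i * L w powr t"
      using C_ge_1 J_pos[of "[i]"] J_pos[of w] Z by (simp add: powr_mult q_def)
    also have "\<dots> \<le> C powr t * Z * q i * ((C powr t * Z) ^ length w * wmass w)"
      using Cons Z p_nonneg by (intro mult_left_mono) auto
    finally show ?case by (simp add: word_mass_def mult_ac)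
  qed
  show ?thesis
  proof (rule Bochner_Integration.integrable_bound)
    show "integrable (count_space (words k)) (\<lambda>w. (C powr t * Z) ^ k * wmass w)"
      by (intro integrable_mult_right integrable_wmass)
    show "AE w in count_space (words k). norm (L w powr t) \<le> norm ((C powr t * Z) ^ k * wmass w)"
      using bound Z wmass_nonneg by (auto simp: AE_count_space abs_mult)
  qed simp
qed

text \<open>Summed over the words of length \<open>k\<close> this is \<open>H - t * \<Lambda> + t * ln C\<close>, where \<open>H\<close> is the entropy
  of a block and \<open>\<Lambda>\<close> the mean of \<open>- ln (L w)\<close>. The single sum can make sense before \<open>H\<close> and
  \<open>\<Lambda>\<close> are known to be finite, because each term has a summable upper bound.\<close>

definition dim_potential :: "(nat \<Rightarrow> real) \<Rightarrow> real \<Rightarrow> nat list \<Rightarrow> real" where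
  "dim_potential p t w = word_mass p w * (t * ln (C * L w) - ln (word_mass p w))"

definition dominates :: "(nat \<Rightarrow> real) \<Rightarrow> real \<Rightarrow> nat \<Rightarrow> bool" where
  "dominates p t k \<longleftrightarrow> integrable (count_space (words k)) (dim_potential p t) \<and>
    0 \<le> (\<integral>w. dim_potential p t w \<partial>count_space (words k))"

text \<open>Since \<open>ln x \<le> x\<close>, the term \<open>m * ln (c / m)\<close> is at most \<open>c\<close>. The bound does not depend on \<open>p\<close>; this
  uniformity gives upper semicontinuity in \<open>p\<close> below.\<close>

lemma dim_potential_le:
  assumes "prob_vector p"
  shows "dim_potential p t w \<le> (C * L w) powr t"
proof -
  interpret bernoulli p by unfold_locales fact
  have CL: "0 < C * L w" using C_ge_1 J_pos[of w] by simp
  show ?thesis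
  proof (cases "wmass w = 0")
    case False
    then have m: "0 < wmass w" using wmass_nonneg[of w] by linarith
    have "t * ln (C * L w) - ln (wmass w) = ln ((C * L w) powr t / wmass w)"
      using CL m by (subst ln_div) (auto simp: ln_powr)
    also have "\<dots> \<le> (C * L w) powr t / wmass w"
      using CL m by (intro ln_bound divide_pos_pos) auto
    finally show ?thesis using m unfolding dim_potential_def
      by (simp add: field_simps)
  qed (simp add: dim_potential_def)
qed

lemma CL_powr_integrable:
  assumes "integrable (count_space (words k)) (\<lambda>w. L w powr t)"
  shows "integrable (count_space (words k)) (\<lambda>w. (C * L w) powr t)"
  using C_ge_1 J_pos assms by (simp add: powr_mult less_imp_le)

text \<open>The positive part of \<open>g = t * ln (C * L w) - ln (word_mass p w)\<close> is integrable, but its mean may be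
  \<open>-\<infinity>\<close> a priori, so \<open>g\<close> is truncated below at \<open>- M\<close>. If a truncated mean were negative, then
  \<open>block_sums_bounded\<close> would give an exponential rate for \<open>L w powr t\<close> against the mass, and
  \<open>measure_dim_code_le\<close> the contradiction \<open>dim \<le> t\<close>. Monotone convergence as \<open>M\<close> grows then shows that \<open>g\<close>
  itself is integrable with nonnegative mean.\<close>

lemma dominates_if_dim_gt:
  assumes p: "prob_vector p" and t: "0 < t" and k: "k \<ge> 1"
    and Lt: "integrable (count_space (words k)) (\<lambda>w. L w powr t)"
    and dim: "ereal t < measure_dim (distr (bernoulli_measure p) borel code)"
  shows "dominates p t k"
proof -
  interpret bernoulli p by unfold_locales fact
  define g where "g w = t * ln (C * L w) - ln (wmass w)" for w
  have pot: "dim_potential p t w = wmass w * g w" for w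
    by (simp add: dim_potential_def g_def)
  define h where "h M w = wmass w * max (g w) (- real M)" for M :: nat and w
  have h_int: "integrable (count_space (words k)) (h M)" for M
  proof (rule Bochner_Integration.integrable_bound)
    show "integrable (count_space (words k)) (\<lambda>w. wmass w * real M + (C * L w) powr t)"
      by (intro Bochner_Integration.integrable_add integrable_mult_left integrable_wmass CL_powr_integrable Lt)
    show "AE w in count_space (words k). norm (h M w) \<le> norm (wmass w * real M + (C * L w) powr t)"
    proof (rule AE_I2)
      fix w
      have "wmass w * g w \<le> (C * L w) powr t" using dim_potential_le[OF p, of t w] by (simp add: pot)
      then have "wmass w * max (g w) 0 \<le> (C * L w) powr t" by (auto simp: max_def)
      moreover have "\<bar>max (g w) (- real M)\<bar> \<le> max (g w) 0 + real M" by (auto simp: max_def abs_if)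
      then have "wmass w * \<bar>max (g w) (- real M)\<bar> \<le> wmass w * (max (g w) 0 + real M)"
        using wmass_nonneg by (rule mult_left_mono)
      ultimately show "norm (h M w) \<le> norm (wmass w * real M + (C * L w) powr t)"
        using wmass_nonneg[of w] by (simp add: h_def abs_mult algebra_simps)
    qed
  qed simp
  have h_nonneg: "0 \<le> (\<integral>w. h M w \<partial>count_space (words k))" for M
  proof (rule ccontr)
    define E where "E = (\<integral>w. h M w \<partial>count_space (words k))"
    assume "\<not> 0 \<le> (\<integral>w. h M w \<partial>count_space (words k))"
    then have E: "E < 0" by (simp add: E_def)
    define \<epsilon> where "\<epsilon> = - E / 4"
    define G where "G w = max (g w) (- real M)" for w
    have "integrable B (\<lambda>\<omega>. G (prefix k \<omega>))" "(\<integral>\<omega>. G (prefix k \<omega>) \<partial>B) = E"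
      using h_int[of M] integrable_prefix_iff[of G k] integral_prefix[of G k]
      by (simp_all add: h_def[abs_def] G_def[abs_def] E_def)
    then have "integrable B (\<lambda>\<omega>. G (prefix k \<omega>) + 2 * \<epsilon>)" "(\<integral>\<omega>. G (prefix k \<omega>) + 2 * \<epsilon> \<partial>B) < 0"
      using E by (auto simp: B.prob_space[simplified] \<epsilon>_def)
    from block_sums_bounded[OF this k]
    have "AE \<omega> in B. \<forall>\<^sub>F n in sequentially.
      L (prefix (n * k) \<omega>) powr t \<le> exp (- (real n * \<epsilon>)) * wmass (prefix (n * k) \<omega>)"
      using AE_positive
    proof eventually_elim
      case (elim \<omega>)
      then obtain K where K: "\<And>n. (\<Sum>j<n. G (prefix k (shift (j * k) \<omega>)) + 2 * \<epsilon>) \<le> K" by auto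
      have "\<forall>\<^sub>F n in sequentially. real n * \<epsilon> \<ge> K"
        using E filterlim_real_sequentially
        by (auto simp: \<epsilon>_def filterlim_at_top intro: eventually_mono[of "\<lambda>n. K / \<epsilon> \<le> real n"] simp: field_simps)
      then show ?case
      proof eventually_elim
        case (elim n)
        let ?w = "prefix (n * k) \<omega>"
        have pos: "0 < wmass ?w" "0 < L ?w"
          using \<open>\<forall>i. 0 < p (\<omega> i)\<close> J_pos by (auto intro: ln_wmass_prefix)
        have "t * ln (L ?w) - ln (wmass ?w) \<le>
            t * (\<Sum>j<n. ln (C * L (prefix k (shift (j * k) \<omega>)))) - (\<Sum>j<n. ln (wmass (prefix k (shift (j * k) \<omega>))))"
          using L_prefix_blocks(1)[where n = n and k = k and \<omega> = \<omega>] ln_wmass_prefix(2)[of \<omega> n k] \<open>\<forall>i. 0 < p (\<omega> i)\<close> t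
          by (auto intro!: mult_left_mono)
        also have "\<dots> = (\<Sum>j<n. g (prefix k (shift (j * k) \<omega>)))"
          by (simp add: g_def sum_subtractf sum_distrib_left)
        also have "\<dots> \<le> (\<Sum>j<n. G (prefix k (shift (j * k) \<omega>)))"
          by (intro sum_mono) (simp add: G_def)
        also have "\<dots> \<le> K - 2 * real n * \<epsilon>"
          using K[of n] by (simp add: sum.distrib)
        also have "\<dots> \<le> - (real n * \<epsilon>)" using elim by linarith
        finally have "t * ln (L ?w) \<le> - (real n * \<epsilon>) + ln (wmass ?w)" by simp
        then have "exp (t * ln (L ?w)) \<le> exp (- (real n * \<epsilon>) + ln (wmass ?w))"
          by (simp only: exp_le_cancel_iff)
        also have "\<dots> = exp (- (real n * \<epsilon>)) * wmass ?w"
          using pos by (simp only: exp_add exp_ln)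
        finally show ?case using pos by (simp add: powr_def)
      qed
    qed
    then have "measure_dim (distr B borel code) \<le> ereal t"
      using measure_dim_code_le[OF p t k, of \<epsilon>] E by (simp add: \<epsilon>_def)
    then show False using dim by simp
  qed
  define I where "I M = (\<integral>w. - h M w \<partial>count_space (words k))" for M
  have h_mono: "h N w \<le> h M w" if "M \<le> N" for M N w
    unfolding h_def using that by (intro mult_left_mono wmass_nonneg max.mono) auto
  have "incseq I"
    unfolding I_def by (intro monoI integral_mono) (use h_int h_mono in auto)
  moreover have "I M \<le> 0" for M using h_nonneg[of M] by (simp add: I_def)
  ultimately obtain l where l: "I \<longlonglongrightarrow> l" "\<And>M. I M \<le> l"
    using incseq_convergent[of I 0] by auto
  have l0: "l \<le> 0" using l(1) \<open>\<And>M. I M \<le> 0\<close> by (auto intro: LIMSEQ_le_const2)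
  have conv: "(\<lambda>M. - h M w) \<longlonglongrightarrow> - (wmass w * g w)" for w
  proof (rule tendsto_eventually)
    have "\<forall>\<^sub>F M in sequentially. - g w \<le> real M"
      using filterlim_real_sequentially by (simp add: filterlim_at_top)
    then show "\<forall>\<^sub>F M in sequentially. - h M w = - (wmass w * g w)"
      by eventually_elim (simp add: h_def max_def)
  qed
  note mct = integrable_monotone_convergence[of "count_space (words k)" "\<lambda>M w. - h M w" "\<lambda>w. - (wmass w * g w)" l]
    integral_monotone_convergence[of "count_space (words k)" "\<lambda>M w. - h M w" "\<lambda>w. - (wmass w * g w)" l]
  have "integrable (count_space (words k)) (\<lambda>w. - (wmass w * g w))"
       "(\<integral>w. - (wmass w * g w) \<partial>count_space (words k)) = l"
    using mct h_int l(1) conv h_mono unfolding I_def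
    by (auto simp: mono_def)
  then show ?thesis using l0 by (simp add: dominates_def pot[abs_def])
qed

text \<open>Upper semicontinuity: Fatou's lemma for the nonnegative functions
  \<open>(C * L w) powr t - dim_potential (q n) t w\<close>.\<close>

lemma dominates_limit:
  assumes q: "\<And>n. prob_vector (q n)" and p: "prob_vector p"
    and lim: "\<And>i. (\<lambda>n. q n i) \<longlonglongrightarrow> p i"
    and Lt: "integrable (count_space (words k)) (\<lambda>w. L w powr t)"
    and dom: "\<And>n. dominates (q n) t k"
  shows "dominates p t k"
proof -
  let ?N = "count_space (words k)"
  let ?f = "\<lambda>w. (C * L w) powr t"
  have f: "integrable ?N ?f" by (rule CL_powr_integrable[OF Lt])
  have lim_pot: "(\<lambda>n. dim_potential (q n) t w) \<longlonglongrightarrow> dim_potential p t w" for w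
  proof -
    have *: "(\<lambda>n. word_mass (q n) w) \<longlonglongrightarrow> word_mass p w" by (rule word_mass_tendsto[OF lim])
    have "0 \<le> word_mass (q n) w" for n
    proof -
      interpret bernoulli "q n" by unfold_locales (rule q)
      show ?thesis by (rule wmass_nonneg)
    qed
    note ** = tendsto_x_ln_x[OF * this]
    show ?thesis unfolding dim_potential_def right_diff_distrib
      by (intro tendsto_diff tendsto_mult * ** tendsto_const)
  qed
  have "(\<integral>\<^sup>+w. ennreal (?f w - dim_potential p t w) \<partial>?N)
      = (\<integral>\<^sup>+w. liminf (\<lambda>n. ennreal (?f w - dim_potential (q n) t w)) \<partial>?N)"
    by (intro nn_integral_cong lim_imp_Liminf[symmetric] tendsto_ennrealI tendsto_diff tendsto_const lim_pot) simp
  also have "\<dots> \<le> liminf (\<lambda>n. \<integral>\<^sup>+w. ennreal (?f w - dim_potential (q n) t w) \<partial>?N)"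
    by (rule nn_integral_liminf) simp
  also have "\<dots> \<le> liminf (\<lambda>n::nat. ennreal (\<integral>w. ?f w \<partial>?N))"
  proof (intro Liminf_mono always_eventually allI)
    fix n
    have d: "integrable ?N (dim_potential (q n) t)" "0 \<le> (\<integral>w. dim_potential (q n) t w \<partial>?N)"
      using dom[of n] by (auto simp: dominates_def)
    have "(\<integral>\<^sup>+w. ennreal (?f w - dim_potential (q n) t w) \<partial>?N) = ennreal (\<integral>w. ?f w - dim_potential (q n) t w \<partial>?N)"
      using dim_potential_le[OF q] by (intro nn_integral_eq_integral Bochner_Integration.integrable_diff f d) auto
    also have "\<dots> \<le> ennreal (\<integral>w. ?f w \<partial>?N)"
      using d f by (intro ennreal_leI) simp
    finally show "(\<integral>\<^sup>+w. ennreal (?f w - dim_potential (q n) t w) \<partial>?N) \<le> ennreal (\<integral>w. ?f w \<partial>?N)" .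
  qed
  also have "\<dots> = ennreal (\<integral>w. ?f w \<partial>?N)" by (simp add: Liminf_const)
  finally have le: "(\<integral>\<^sup>+w. ennreal (?f w - dim_potential p t w) \<partial>?N) \<le> ennreal (\<integral>w. ?f w \<partial>?N)" .
  have i: "integrable ?N (\<lambda>w. ?f w - dim_potential p t w)"
    using le dim_potential_le[OF p]
    by (intro integrableI_nonneg) (auto intro: le_less_trans)
  then have "integrable ?N (\<lambda>w. ?f w - (?f w - dim_potential p t w))"
    by (rule Bochner_Integration.integrable_diff[OF f])
  moreover have "(\<lambda>w. ?f w - (?f w - dim_potential p t w)) = dim_potential p t" by auto
  ultimately have pot: "integrable ?N (dim_potential p t)" by (simp only:)
  have "ennreal (\<integral>w. ?f w - dim_potential p t w \<partial>?N) \<le> ennreal (\<integral>w. ?f w \<partial>?N)"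
    using le by (subst nn_integral_eq_integral[symmetric]) (use i dim_potential_le[OF p] in auto)
  then have "(\<integral>w. ?f w - dim_potential p t w \<partial>?N) \<le> (\<integral>w. ?f w \<partial>?N)"
    by (subst (asm) ennreal_le_iff) auto
  then show ?thesis using pot f by (simp add: dominates_def)
qed

text \<open>The difference \<open>dim_potential p s - dim_potential p t\<close> is \<open>(t - s)\<close> times the mass times
  \<open>- ln (C * L w)\<close>. Its first term is bounded by \<open>(C * L w) powr s\<close> and the second has a nonnegative sum;
  so the mean of \<open>- ln (L w)\<close> has a bound that does not depend on \<open>p\<close>.\<close>

lemma dominates_lyapunov:
  assumes p: "prob_vector p" and s: "s < t" and dom: "dominates p t k"
    and Ls: "integrable (count_space (words k)) (\<lambda>w. L w powr s)"
  shows "integrable (count_space (words k)) (\<lambda>w. word_mass p w * - ln (L w))"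
    and "(t - s) * (\<integral>w. word_mass p w * - ln (L w) \<partial>count_space (words k))
      \<le> (\<integral>w. (C * L w) powr s \<partial>count_space (words k)) + (t - s) * ln C"
proof -
  interpret bernoulli p by unfold_locales fact
  let ?N = "count_space (words k)"
  let ?l = "\<lambda>w. wmass w * - ln (L w)"
  let ?r = "\<lambda>w. (C * L w) powr s - dim_potential p t w + (t - s) * ln C * wmass w"
  have d: "integrable ?N (dim_potential p t)" "0 \<le> (\<integral>w. dim_potential p t w \<partial>?N)"
    using dom by (auto simp: dominates_def)
  have f: "integrable ?N (\<lambda>w. (C * L w) powr s)" by (rule CL_powr_integrable[OF Ls])
  have r: "integrable ?N ?r"
    by (intro Bochner_Integration.integrable_add Bochner_Integration.integrable_diff f d integrable_mult_right integrable_wmass)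
  have le: "(t - s) * ?l w \<le> ?r w" for w
  proof -
    have "ln (C * L w) = ln C + ln (L w)" using C_ge_1 J_pos[of w] by (simp add: ln_mult)
    then have "(t - s) * ?l w = dim_potential p s w - dim_potential p t w + (t - s) * ln C * wmass w"
      by (simp add: dim_potential_def algebra_simps)
    then show ?thesis using dim_potential_le[OF p, of s w] by simp
  qed
  have nonneg: "0 \<le> ?l w" for w
    using L_le_1[of w] J_pos[of w] by (intro mult_nonneg_nonneg wmass_nonneg) simp
  have i: "integrable ?N (\<lambda>w. (t - s) * ?l w)"
  proof (rule Bochner_Integration.integrable_bound[OF r])
    show "AE w in ?N. norm ((t - s) * ?l w) \<le> norm (?r w)"
    proof (rule AE_I2)
      fix w
      have "0 \<le> (t - s) * ?l w" using s by (intro mult_nonneg_nonneg nonneg) simp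
      then show "norm ((t - s) * ?l w) \<le> norm (?r w)" using le[of w] unfolding real_norm_def by linarith
    qed
  qed simp
  then have "integrable ?N (\<lambda>w. inverse (t - s) * ((t - s) * ?l w))" by (rule integrable_mult_right)
  moreover have "inverse (t - s) * ((t - s) * ?l w) = ?l w" for w
    using s by (metis (no_types) diff_gt_0_iff_gt less_numeral_extra(3) left_inverse mult.assoc mult_1)
  ultimately show int: "integrable ?N ?l" by (simp only:)
  have "(t - s) * (\<integral>w. ?l w \<partial>?N) = (\<integral>w. (t - s) * ?l w \<partial>?N)" by simp
  also have "\<dots> \<le> (\<integral>w. ?r w \<partial>?N)" by (rule integral_mono[OF i r le])
  also have "\<dots> = (\<integral>w. (C * L w) powr s \<partial>?N) - (\<integral>w. dim_potential p t w \<partial>?N) + (t - s) * ln C"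
    using f d integrable_wmass[of k] integral_wmass[of k] by simp
  finally show "(t - s) * (\<integral>w. ?l w \<partial>?N) \<le> (\<integral>w. (C * L w) powr s \<partial>?N) + (t - s) * ln C"
    using d by simp
qed

end

section \<open>Lower bound for the dimension\<close>

context cylinder_system
begin

lemma interval_in_J:
  assumes \<delta>: "0 < \<delta>" "\<delta> \<le> L w" and z: "z \<in> closure (J w)"
  shows "\<exists>u. {u<..<u + \<delta> / 4} \<subseteq> J w \<and> z - \<delta> / 2 \<le> u \<and> u + \<delta> / 4 \<le> z + \<delta> / 2"
proof -
  obtain y where y: "y \<in> J w" "\<bar>y - z\<bar> < \<delta> / 4"
    using z \<delta> unfolding closure_approachable dist_real_def by (metis divide_pos_pos zero_less_numeral)
  have "\<exists>y'\<in>J w. \<delta> / 4 \<le> \<bar>y' - y\<bar>"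
  proof (rule ccontr)
    assume "\<not> ?thesis"
    then have close: "\<bar>y' - y\<bar> \<le> \<delta> / 4" if "y' \<in> J w" for y' using that by force
    then have "\<bar>y1 - y2\<bar> \<le> \<delta> / 2" if "y1 \<in> J w" "y2 \<in> J w" for y1 y2
      using close[OF that(1)] close[OF that(2)] by linarith
    then have "L w \<le> \<delta> / 2"
      using J_nonempty by (intro diameter_le) (auto simp: dist_real_def)
    then show False using \<delta> by simp
  qed
  then obtain y' where y': "y' \<in> J w" "\<delta> / 4 \<le> \<bar>y' - y\<bar>" by blast
  have conv: "{min y y'..max y y'} \<subseteq> J w"
  proof
    fix x assume x: "x \<in> {min y y'..max y y'}"
    have "is_interval (J w)" using J_convex by (simp add: is_interval_convex_1)
    moreover have "min y y' \<in> J w" "max y y' \<in> J w" using y y' by (simp_all add: min_def max_def)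
    ultimately show "x \<in> J w" using x by (meson atLeastAtMost_iff mem_is_interval_1_I)
  qed
  show ?thesis
  proof (cases "y < y'")
    case True
    then have "{y<..<y + \<delta> / 4} \<subseteq> {min y y'..max y y'}" using y' by auto
    then show ?thesis using conv y by (intro exI[of _ y]) (auto simp: abs_if split: if_splits)
  next
    case False
    then have "{y - \<delta> / 4<..<y - \<delta> / 4 + \<delta> / 4} \<subseteq> {min y y'..max y y'}" using y' by auto
    then show ?thesis using conv y \<delta>
      by (intro exI[of _ "y - \<delta> / 4"]) (auto simp: abs_if split: if_splits)
  qed
qed

text \<open>Cylinders of one level are disjoint. Each one counted here contains an interval of length \<open>\<delta> / 4\<close> within
  distance \<open>\<delta> / 2\<close> of \<open>{c..c + d}\<close>, and Lebesgue measure bounds the number of these intervals.\<close>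

lemma card_long_cylinders:
  assumes \<delta>: "0 < \<delta>" and d: "0 \<le> d" and F: "F \<subseteq> words n"
    and long: "\<And>w. w \<in> F \<Longrightarrow> \<delta> \<le> L w" and meet: "\<And>w. w \<in> F \<Longrightarrow> closure (J w) \<inter> {c..c + d} \<noteq> {}"
  shows "finite F" and "real (card F) \<le> 4 * (d / \<delta>) + 4"
proof -
  have bound: "real (card G) \<le> 4 * (d / \<delta>) + 4" if G: "G \<subseteq> F" "finite G" for G
  proof -
    have "\<exists>u. {u<..<u + \<delta> / 4} \<subseteq> J w \<and> c - \<delta> / 2 \<le> u \<and> u + \<delta> / 4 \<le> c + d + \<delta> / 2" if w: "w \<in> G" for w
    proof -
      obtain z where z: "z \<in> closure (J w)" "c \<le> z" "z \<le> c + d" using meet[of w] w G by fastforce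
      show ?thesis using interval_in_J[OF \<delta> long z(1)] w G z(2,3) by force
    qed
    then obtain u where u: "\<And>w. w \<in> G \<Longrightarrow> {u w<..<u w + \<delta> / 4} \<subseteq> J w"
        "\<And>w. w \<in> G \<Longrightarrow> c - \<delta> / 2 \<le> u w" "\<And>w. w \<in> G \<Longrightarrow> u w + \<delta> / 4 \<le> c + d + \<delta> / 2"
      by metis
    have disj: "disjoint_family_on (\<lambda>w. {u w<..<u w + \<delta> / 4}) G"
      unfolding disjoint_family_on_def
    proof (intro ballI impI)
      fix v w assume "v \<in> G" "w \<in> G" "v \<noteq> w"
      moreover have "J v \<inter> J w = {}" using calculation G F by (intro J_disjoint) auto
      ultimately show "{u v<..<u v + \<delta> / 4} \<inter> {u w<..<u w + \<delta> / 4} = {}"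
        using u(1)[of v] u(1)[of w] by blast
    qed
    have "ennreal (real (card G) * (\<delta> / 4)) = of_nat (card G) * ennreal (\<delta> / 4)"
      using \<delta> by (subst ennreal_mult) (auto simp: ennreal_of_nat_eq_real_of_nat)
    also have "\<dots> = (\<Sum>w\<in>G. emeasure lborel {u w<..<u w + \<delta> / 4})"
      using \<delta> by simp
    also have "\<dots> = emeasure lborel (\<Union>w\<in>G. {u w<..<u w + \<delta> / 4})"
      by (rule sum_emeasure[OF _ disj G(2)]) auto
    also have "\<dots> \<le> emeasure lborel {c - \<delta> / 2..c + d + \<delta> / 2}"
      using u by (intro emeasure_mono) fastforce+
    also have "\<dots> = ennreal (d + \<delta>)" using \<delta> d by simp
    finally have "real (card G) * (\<delta> / 4) \<le> d + \<delta>" using \<delta> d by (subst (asm) ennreal_le_iff) auto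
    then show ?thesis using \<delta> by (simp add: field_simps)
  qed
  show "finite F"
  proof (rule ccontr)
    assume "infinite F"
    then obtain G where G: "finite G" "G \<subseteq> F" "card G = nat \<lceil>4 * (d / \<delta>) + 5\<rceil>"
      using infinite_arbitrarily_large by blast
    then show False using bound[of G] by linarith
  qed
  then show "real (card F) \<le> 4 * (d / \<delta>) + 4" using bound by blast
qed

text \<open>For almost every sequence there is a \<open>K\<close> such that, for all \<open>n\<close> at once, the cylinder at level
  \<open>n * k\<close> has mass at most \<open>exp (K - n * a)\<close> and length at least \<open>exp (- K - n * \<beta>)\<close>, where
  \<open>a < H\<close>, \<open>\<beta> > \<Lambda> + ln C\<close> and \<open>a = t * \<beta>\<close>. An interval of length \<open>d\<close> is compared with
  the single level \<open>n\<close> for which \<open>d\<close> is about \<open>exp (- n * \<beta>)\<close>: by the lower bound for the lengths it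
  meets boundedly many such cylinders, however small the other cylinders of that level
  are, and their mass is of order \<open>exp (- n * a) = exp (- n * \<beta>) powr t\<close>.\<close>

lemma measure_dim_code_ge:
  assumes p: "prob_vector p" and t: "0 < t" and k: "k \<ge> 1"
    and mint: "integrable (count_space (words k)) (\<lambda>w. word_mass p w * - ln (word_mass p w))"
    and Lint: "integrable (count_space (words k)) (\<lambda>w. word_mass p w * - ln (L w))"
    and less: "t * ((\<integral>w. word_mass p w * - ln (L w) \<partial>count_space (words k)) + ln C)
      < (\<integral>w. word_mass p w * - ln (word_mass p w) \<partial>count_space (words k))"
  shows "ereal t \<le> measure_dim (distr (bernoulli_measure p) borel code)"
proof -
  interpret bernoulli p by unfold_locales fact
  define \<Lambda> where "\<Lambda> = (\<integral>w. wmass w * - ln (L w) \<partial>count_space (words k))"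
  define H where "H = (\<integral>w. wmass w * - ln (wmass w) \<partial>count_space (words k))"
  (* half of the slack in the hypothesis, so that both strict inequalities below survive *)
  define \<eta> where "\<eta> = (H - t * (\<Lambda> + ln C)) / (2 * t)"
  have \<eta>: "0 < \<eta>" using less t by (simp add: \<eta>_def H_def \<Lambda>_def)
  define \<beta> where "\<beta> = \<Lambda> + \<eta> + ln C"
  define a where "a = t * \<beta>"
  have "t * \<eta> = (H - t * (\<Lambda> + ln C)) / 2" using t by (simp add: \<eta>_def)
  moreover have "t * (\<Lambda> + ln C) < H" using less by (simp add: H_def \<Lambda>_def)
  ultimately have aH: "a < H" unfolding a_def \<beta>_def by (simp add: algebra_simps)
  have "0 \<le> \<Lambda>" unfolding \<Lambda>_def
  proof (rule Bochner_Integration.integral_nonneg)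
    show "0 \<le> wmass w * - ln (L w)" for w
      using L_le_1[of w] J_pos[of w] by (intro mult_nonneg_nonneg wmass_nonneg) simp
  qed
  then have \<beta>: "0 < \<beta>" using \<eta> C_ge_1 by (simp add: \<beta>_def add_nonneg_pos add_pos_nonneg)
  have code[measurable]: "code \<in> borel_measurable B" by (rule code_measurable[OF p])
  define E where "E K = {\<omega>. \<forall>n. wmass (prefix (n * k) \<omega>) \<le> exp (real K - real n * a)
      \<and> exp (- real K - real n * \<beta>) \<le> L (prefix (n * k) \<omega>)}" for K :: nat
  have E[measurable]: "E K \<in> sets B" for K
  proof -
    have "(\<lambda>\<omega>. f (prefix n \<omega>)) \<in> borel_measurable B" for n and f :: "nat list \<Rightarrow> real"
      by (rule measurable_compose[OF prefix_measurable]) simp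
    note [measurable] = this[of wmass] this[of L]
    have "{\<omega> \<in> space B. \<forall>n. wmass (prefix (n * k) \<omega>) \<le> exp (real K - real n * a)
      \<and> exp (- real K - real n * \<beta>) \<le> L (prefix (n * k) \<omega>)} \<in> sets B" by measurable
    then show ?thesis by (simp add: E_def)
  qed
  have m1: "integrable B (\<lambda>\<omega>. ln (wmass (prefix k \<omega>)) + a)" "(\<integral>\<omega>. ln (wmass (prefix k \<omega>)) + a \<partial>B) < 0"
  proof -
    have i: "integrable B (\<lambda>\<omega>. - ln (wmass (prefix k \<omega>)))" "(\<integral>\<omega>. - ln (wmass (prefix k \<omega>)) \<partial>B) = H"
      using integrable_prefix_iff[of "\<lambda>w. - ln (wmass w)" k] integral_prefix[of "\<lambda>w. - ln (wmass w)" k] mint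
      by (simp_all add: H_def)
    then show "integrable B (\<lambda>\<omega>. ln (wmass (prefix k \<omega>)) + a)" by simp
    show "(\<integral>\<omega>. ln (wmass (prefix k \<omega>)) + a \<partial>B) < 0"
      using i aH by (simp add: B.prob_space[simplified])
  qed
  have m2: "integrable B (\<lambda>\<omega>. - ln (L (prefix k \<omega>)) - (\<Lambda> + \<eta>))"
      "(\<integral>\<omega>. - ln (L (prefix k \<omega>)) - (\<Lambda> + \<eta>) \<partial>B) < 0"
  proof -
    have i: "integrable B (\<lambda>\<omega>. - ln (L (prefix k \<omega>)))" "(\<integral>\<omega>. - ln (L (prefix k \<omega>)) \<partial>B) = \<Lambda>"
      using integrable_prefix_iff[of "\<lambda>w. - ln (L w)" k] integral_prefix[of "\<lambda>w. - ln (L w)" k] Lint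
      by (simp_all add: \<Lambda>_def)
    then show "integrable B (\<lambda>\<omega>. - ln (L (prefix k \<omega>)) - (\<Lambda> + \<eta>))" by simp
    show "(\<integral>\<omega>. - ln (L (prefix k \<omega>)) - (\<Lambda> + \<eta>) \<partial>B) < 0"
      using i \<eta> by (simp add: B.prob_space[simplified])
  qed
  have "AE \<omega> in B. \<omega> \<in> (\<Union>K. E K)"
    using block_sums_bounded[OF m1 k] block_sums_bounded[OF m2 k] AE_positive
  proof eventually_elim
    case (elim \<omega>)
    then obtain K1 K2 where K1: "\<And>n. (\<Sum>j<n. ln (wmass (prefix k (shift (j * k) \<omega>))) + a) \<le> K1"
      and K2: "\<And>n. (\<Sum>j<n. - ln (L (prefix k (shift (j * k) \<omega>))) - (\<Lambda> + \<eta>)) \<le> K2" by blast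
    define K where "K = nat \<lceil>max K1 K2\<rceil>"
    have K: "K1 \<le> real K" "K2 \<le> real K" unfolding K_def by linarith+
    have "\<omega> \<in> E K" unfolding E_def
    proof (intro CollectI allI conjI)
      fix n
      have pos: "0 < wmass (prefix (n * k) \<omega>)" "0 < L (prefix (n * k) \<omega>)"
        using elim J_pos by (auto intro: ln_wmass_prefix)
      have "ln (wmass (prefix (n * k) \<omega>)) \<le> real K - real n * a"
        using K1[of n] K ln_wmass_prefix(2)[of \<omega> n k] elim by (simp add: sum.distrib)
      then show "wmass (prefix (n * k) \<omega>) \<le> exp (real K - real n * a)"
        using pos by (metis exp_le_cancel_iff exp_ln)
      have "- real K - real n * \<beta> \<le> ln (L (prefix (n * k) \<omega>))"
        using K2[of n] K L_prefix_blocks(2)[where n = n and k = k and \<omega> = \<omega>]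
        by (simp add: sum_subtractf sum_negf \<beta>_def algebra_simps)
      then show "exp (- real K - real n * \<beta>) \<le> L (prefix (n * k) \<omega>)"
        using pos by (metis exp_le_cancel_iff exp_ln)
    qed
    then show ?case by blast
  qed
  then have "emeasure B (\<Union>K. E K) = 1"
    by (intro B.emeasure_eq_1_AE) auto
  moreover have "emeasure B (\<Union>K. E K) = 0" if "\<And>K. emeasure B (E K) = 0"
    using that by (intro emeasure_UN_eq_0) auto
  ultimately obtain K where K: "0 < emeasure B (E K)"
    by (metis not_gr_zero zero_neq_one)
  define M where "M = (4 * exp (real K) + 4) * exp (real K + a)"
  have pos_d: "emeasure B {\<omega> \<in> E K. code \<omega> \<in> {c..c + d}} \<le> ennreal (M * d powr t)"
    if d: "0 < d" "d \<le> 1" for c d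
  proof -
    (* the level with exp (- (n + 1) * beta) < d <= exp (- n * beta) *)
    define n where "n = nat \<lfloor>- ln d / \<beta>\<rfloor>"
    have "0 \<le> - ln d / \<beta>" using d \<beta> by (simp add: divide_nonpos_pos)
    then have "real n \<le> - ln d / \<beta>" "- ln d / \<beta> < real n + 1" unfolding n_def by linarith+
    then have n: "real n * \<beta> \<le> - ln d" "- ln d < (real n + 1) * \<beta>"
      using \<beta> by (auto simp: field_simps)
    define \<delta> where "\<delta> = exp (- real K - real n * \<beta>)"
    define F where "F = {w \<in> words (n * k). wmass w \<le> exp (real K - real n * a) \<and> \<delta> \<le> L w \<and> closure (J w) \<inter> {c..c + d} \<noteq> {}}"
    have \<delta>: "0 < \<delta>" by (simp add: \<delta>_def)
    have sub: "F \<subseteq> words (n * k)" by (auto simp: F_def)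
    have F: "finite F" "real (card F) \<le> 4 * (d / \<delta>) + 4"
      by (rule card_long_cylinders[OF \<delta> less_imp_le[OF d(1)] sub, of c]; simp add: F_def)+
    have "d \<le> exp (- (real n * \<beta>))" using n(1) d by (metis exp_le_cancel_iff exp_ln le_minus_iff)
    then have "d / \<delta> \<le> exp (real K)"
      unfolding \<delta>_def by (simp add: exp_diff exp_minus field_simps)
    then have cardF: "real (card F) \<le> 4 * exp (real K) + 4" using F(2) by linarith
    have mass: "exp (real K - real n * a) \<le> exp (real K + a) * d powr t"
    proof -
      have "t * - ln d \<le> t * ((real n + 1) * \<beta>)" using n(2) t by (intro mult_left_mono) auto
      then have "real K - real n * a \<le> real K + a + t * ln d"
        unfolding a_def by (simp add: algebra_simps)
      then have "exp (real K - real n * a) \<le> exp (real K + a + t * ln d)" by simp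
      then show ?thesis using d by (simp add: exp_add powr_def)
    qed
    have cyl: "{\<omega>. prefix (n * k) \<omega> = w} \<in> sets B" for w
    proof -
      have "{\<omega>. prefix (n * k) \<omega> = w} = prefix (n * k) -` {w} \<inter> space B" by auto
      also have "\<dots> \<in> sets B" by (rule measurable_sets[OF prefix_measurable]) simp
      finally show ?thesis .
    qed
    have "{\<omega> \<in> E K. code \<omega> \<in> {c..c + d}} \<subseteq> (\<Union>w\<in>F. {\<omega>. prefix (n * k) \<omega> = w})"
    proof
      fix \<omega> assume "\<omega> \<in> {\<omega> \<in> E K. code \<omega> \<in> {c..c + d}}"
      then have "prefix (n * k) \<omega> \<in> F"
        using code_mem[of \<omega> "n * k"] unfolding F_def E_def \<delta>_def by auto
      then show "\<omega> \<in> (\<Union>w\<in>F. {\<omega>. prefix (n * k) \<omega> = w})" by blast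
    qed
    then have "emeasure B {\<omega> \<in> E K. code \<omega> \<in> {c..c + d}} \<le> emeasure B (\<Union>w\<in>F. {\<omega>. prefix (n * k) \<omega> = w})"
      using F cyl by (intro emeasure_mono) auto
    also have "\<dots> \<le> (\<Sum>w\<in>F. emeasure B {\<omega>. prefix (n * k) \<omega> = w})"
      using F cyl by (intro emeasure_subadditive_finite) auto
    also have "\<dots> = (\<Sum>w\<in>F. ennreal (wmass w))"
      by (intro sum.cong emeasure_cylinder) (auto simp: F_def)
    also have "\<dots> = ennreal (\<Sum>w\<in>F. wmass w)"
      by (rule sum_ennreal) (rule wmass_nonneg)
    also have "\<dots> \<le> ennreal (M * d powr t)"
    proof (rule ennreal_leI)
      have "(\<Sum>w\<in>F. wmass w) \<le> real (card F) * exp (real K - real n * a)"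
        using sum_bounded_above[of F wmass "exp (real K - real n * a)"] by (simp add: F_def)
      also have "\<dots> \<le> (4 * exp (real K) + 4) * (exp (real K + a) * d powr t)"
        using cardF mass by (intro mult_mono) auto
      finally show "(\<Sum>w\<in>F. wmass w) \<le> M * d powr t" by (simp add: M_def mult.assoc)
    qed
    finally show ?thesis .
  qed
  have zero_d: "emeasure B {\<omega> \<in> E K. code \<omega> \<in> {c..c}} \<le> ennreal 0" for c
  proof (rule LIMSEQ_le_const, rule tendsto_ennrealI)
    show "(\<lambda>n. M * (1 / real (Suc n)) powr t) \<longlonglongrightarrow> 0"
    proof (rule tendsto_mult_right_zero)
      have "(\<lambda>n. (1 / real (Suc n)) powr t) \<longlonglongrightarrow> 0 powr t"
        using LIMSEQ_inverse_real_of_nat t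
        by (intro tendsto_powr2) (auto simp: inverse_eq_divide)
      then show "(\<lambda>n. (1 / real (Suc n)) powr t) \<longlonglongrightarrow> 0" using t by simp
    qed
    show "\<exists>N. \<forall>n\<ge>N. emeasure B {\<omega> \<in> E K. code \<omega> \<in> {c..c}} \<le> ennreal (M * (1 / real (Suc n)) powr t)"
    proof (intro exI[of _ 0] allI impI)
      fix n
      have "{\<omega> \<in> E K. code \<omega> \<in> {c..c + 1 / real (Suc n)}} = E K \<inter> (code -` {c..c + 1 / real (Suc n)} \<inter> space B)" by auto
      also have "\<dots> \<in> sets B" by measurable
      finally have "emeasure B {\<omega> \<in> E K. code \<omega> \<in> {c..c}} \<le> emeasure B {\<omega> \<in> E K. code \<omega> \<in> {c..c + 1 / real (Suc n)}}"
        by (intro emeasure_mono) auto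
      also have "\<dots> \<le> ennreal (M * (1 / real (Suc n)) powr t)" by (rule pos_d) auto
      finally show "emeasure B {\<omega> \<in> E K. code \<omega> \<in> {c..c}} \<le> ennreal (M * (1 / real (Suc n)) powr t)" .
    qed
  qed
  show ?thesis
  proof (rule measure_dim_ge[OF prob_space_B code E K _ t])
    show "0 \<le> M" by (simp add: M_def)
    show "emeasure B {\<omega> \<in> E K. code \<omega> \<in> {c..c + d}} \<le> ennreal (M * d powr t)" if "0 \<le> d" "d \<le> 1" for c d
      using pos_d[of d c] zero_d[of c] that t by (cases "d = 0") auto
  qed
qed

text \<open>Dominance at the exponent \<open>t\<close> gives \<open>H \<ge> t * (\<Lambda> - ln C)\<close>, whereas the lower bound for
  the dimension asks for \<open>H > t' * (\<Lambda> + ln C)\<close>. Because of the exponential decay of the lengths, \<open>\<Lambda>\<close>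
  grows linearly with the block length \<open>k\<close>, so the constant \<open>ln C\<close> does not matter for large \<open>k\<close>.\<close>

lemma measure_dim_ge_if_dominates:
  assumes p: "prob_vector p" and t: "0 < t'" "t' < t" and s: "s < t"
    and Ls: "\<And>k. integrable (count_space (words k)) (\<lambda>w. L w powr s)"
    and dom: "\<And>k. k \<ge> 1 \<Longrightarrow> dominates p t k"
  shows "ereal t' \<le> measure_dim (distr (bernoulli_measure p) borel code)"
proof -
  interpret bernoulli p by unfold_locales fact
  define \<Lambda> where "\<Lambda> k = (\<integral>w. wmass w * - ln (L w) \<partial>count_space (words k))" for k
  (* chosen so that (t + t') * ln C < (t - t') * Lambda k, from Lambda k >= - k * ln rho - ln C0 *)
  define k where "k = Suc (nat \<lceil>((t + t') * ln C / (t - t') + ln C0) / - ln \<rho>\<rceil>)"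
  have k: "k \<ge> 1" by (simp add: k_def)
  have ln\<rho>: "0 < - ln \<rho>" using \<rho> by simp
  have Lint: "integrable (count_space (words k)) (\<lambda>w. wmass w * - ln (L w))"
    by (rule dominates_lyapunov[OF p s dom[OF k] Ls])
  have "real k * - ln \<rho> - ln C0 = (\<integral>w. wmass w * (real k * - ln \<rho> - ln C0) \<partial>count_space (words k))"
    using integral_wmass[of k] integrable_wmass[of k] by simp
  also have "\<dots> \<le> \<Lambda> k" unfolding \<Lambda>_def
  proof (rule integral_mono)
    show "integrable (count_space (words k)) (\<lambda>w. wmass w * (real k * - ln \<rho> - ln C0))"
      using integrable_wmass by (rule integrable_mult_left)
    fix w assume "w \<in> space (count_space (words k))"
    then have w: "length w = k" by simp
    have "ln (L w) \<le> ln (C0 * \<rho> ^ k)"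
      using L_decay[of w] J_pos[of w] \<rho> C0 w by (subst ln_le_cancel_iff) auto
    then have "real k * - ln \<rho> - ln C0 \<le> - ln (L w)"
      using \<rho> C0 by (simp add: ln_mult ln_realpow)
    then show "wmass w * (real k * - ln \<rho> - ln C0) \<le> wmass w * - ln (L w)"
      by (rule mult_left_mono) (rule wmass_nonneg)
  qed (rule Lint)
  finally have "real k * - ln \<rho> - ln C0 \<le> \<Lambda> k" .
  moreover have "((t + t') * ln C / (t - t') + ln C0) / - ln \<rho> < real k"
    unfolding k_def by linarith
  then have "(t + t') * ln C / (t - t') + ln C0 < real k * - ln \<rho>"
    using ln\<rho> by (subst (asm) pos_divide_less_eq) auto
  ultimately have "(t + t') * ln C / (t - t') < \<Lambda> k" by simp
  then have big: "(t + t') * ln C < (t - t') * \<Lambda> k"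
    using t by (subst (asm) pos_divide_less_eq) (auto simp: mult.commute)
  have d: "integrable (count_space (words k)) (dim_potential p t)"
      "0 \<le> (\<integral>w. dim_potential p t w \<partial>count_space (words k))"
    using dom[OF k] by (auto simp: dominates_def)
  have eq: "wmass w * - ln (wmass w) = dim_potential p t w - t * ln C * wmass w + t * (wmass w * - ln (L w))" for w
  proof -
    have "ln (C * L w) = ln C + ln (L w)" using C_ge_1 J_pos[of w] by (simp add: ln_mult)
    then show ?thesis by (simp add: dim_potential_def algebra_simps)
  qed
  have mint: "integrable (count_space (words k)) (\<lambda>w. wmass w * - ln (wmass w))"
    unfolding eq by (intro Bochner_Integration.integrable_add Bochner_Integration.integrable_diff
        d integrable_mult_right integrable_wmass Lint)
  have "(\<integral>w. wmass w * - ln (wmass w) \<partial>count_space (words k))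
      = (\<integral>w. dim_potential p t w \<partial>count_space (words k)) - t * ln C + t * \<Lambda> k"
    unfolding eq \<Lambda>_def using d Lint integrable_wmass[of k] integral_wmass[of k]
    by (subst Bochner_Integration.integral_add Bochner_Integration.integral_diff;
        (intro Bochner_Integration.integrable_diff integrable_mult_right)?; simp)+
  then have "t' * (\<Lambda> k + ln C) < (\<integral>w. wmass w * - ln (wmass w) \<partial>count_space (words k))"
    using d big by (simp add: algebra_simps)
  then show ?thesis
    using measure_dim_code_ge[OF p t(1) k mint Lint] by (simp add: \<Lambda>_def)
qed

end

section \<open>Existence of a maximizing probability vector\<close>

lemma bounded_sequence_pointwise_convergent:
  fixes q :: "nat \<Rightarrow> nat \<Rightarrow> real"
  assumes "\<And>n i. 0 \<le> q n i" "\<And>n i. q n i \<le> 1"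
  shows "\<exists>r l. strict_mono (r :: nat \<Rightarrow> nat) \<and> (\<forall>i. (\<lambda>n. q (r n) i) \<longlonglongrightarrow> l i)"
proof -
  define S where "S = (\<Pi>\<^sub>E i\<in>(UNIV::nat set). {0..1::real})"
  have "compactin (product_topology (\<lambda>_. euclidean) UNIV) S"
    unfolding S_def by (subst compactin_PiE) auto
  then have "compact S" by (simp add: euclidean_product_topology)
  moreover have "\<forall>n. q n \<in> S" using assms by (auto simp: S_def)
  ultimately obtain l r where r: "strict_mono (r :: nat \<Rightarrow> nat)" "(q \<circ> r) \<longlonglongrightarrow> l"
    using compact_imp_seq_compact unfolding seq_compact_def by metis
  have "(\<lambda>n. q (r n) i) \<longlonglongrightarrow> l i" for i
    using continuous_on_tendsto_compose[OF continuous_on_product_coordinates[of i] r(2)]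
    by simp
  then show ?thesis using r by blast
qed

text \<open>The bound for the means of a function \<open>c\<close> tending to infinity is tightness: by Markov's inequality no
  mass escapes to infinity.\<close>

lemma prob_vector_limit:
  fixes q :: "nat \<Rightarrow> nat \<Rightarrow> real" and c :: "nat \<Rightarrow> real"
  assumes q: "\<And>n. prob_vector (q n)" and lim: "\<And>i. (\<lambda>n. q n i) \<longlonglongrightarrow> p i"
    and c: "filterlim c at_top sequentially" "\<And>i. 0 \<le> c i"
    and tight: "\<And>n (I :: nat set). finite I \<Longrightarrow> (\<Sum>i\<in>I. q n i * c i) \<le> b"
  shows "prob_vector p"
proof -
  have q_nonneg: "0 \<le> q n i" and q_sums: "q n sums 1" for n i
    using q by (auto simp: prob_vector_def)
  have p_nonneg: "0 \<le> p i" for i by (rule LIMSEQ_le_const[OF lim]) (use q_nonneg in auto)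
  have sum_lim: "(\<lambda>n. \<Sum>i<N. q n i) \<longlonglongrightarrow> (\<Sum>i<N. p i)" for N
    by (intro tendsto_sum lim)
  have part: "(\<Sum>i<N. q n i) \<le> 1" for N n
    using q_sums[of n] q_nonneg by (metis sums_iff sum_le_suminf finite_lessThan)
  have p_part: "(\<Sum>i<N. p i) \<le> 1" for N
    by (rule LIMSEQ_le_const2[OF sum_lim]) (use part in auto)
  have sm: "summable p"
    using p_nonneg p_part by (intro summableI_nonneg_bounded[of p 1]) auto
  have "suminf p \<le> 1" using sm p_part by (intro suminf_le_const)
  moreover have "1 \<le> suminf p"
  proof (rule field_le_epsilon)
    fix e :: real assume e: "0 < e"
    define b' where "b' = max b 1"
    have b': "0 < b'" "b \<le> b'" by (auto simp: b'_def)
    obtain N where N: "\<And>i. i \<ge> N \<Longrightarrow> b' / e \<le> c i"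
      using c(1) unfolding filterlim_at_top eventually_sequentially by blast
    have "1 - e \<le> (\<Sum>i<N. q n i)" for n
    proof -
      have "(\<Sum>i<M. q n i) \<le> (\<Sum>i<N. q n i) + e" for M
      proof -
        have "(\<Sum>i\<in>{N..<M}. q n i) * (b' / e) \<le> (\<Sum>i\<in>{N..<M}. q n i * c i)"
          unfolding sum_distrib_right using N q_nonneg by (intro sum_mono mult_left_mono) auto
        also have "\<dots> \<le> b'" using tight[of "{N..<M}" n] b' by simp
        finally have "(\<Sum>i\<in>{N..<M}. q n i) \<le> e" using b' e by (simp add: field_simps)
        moreover have "(\<Sum>i<M. q n i) \<le> (\<Sum>i\<in>{..<N} \<union> {N..<M}. q n i)"
          using q_nonneg by (intro sum_mono2) auto
        moreover have "(\<Sum>i\<in>{..<N} \<union> {N..<M}. q n i) = (\<Sum>i<N. q n i) + (\<Sum>i\<in>{N..<M}. q n i)"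
          by (rule sum.union_disjoint) auto
        ultimately show ?thesis by simp
      qed
      then have "1 \<le> (\<Sum>i<N. q n i) + e"
        using q_sums[of n] unfolding sums_def by (intro LIMSEQ_le_const2[where X = "\<lambda>M. \<Sum>i<M. q n i"]) auto
      then show ?thesis by simp
    qed
    then have "1 - e \<le> (\<Sum>i<N. p i)" by (intro LIMSEQ_le_const[OF sum_lim]) auto
    also have "\<dots> \<le> suminf p" using sm p_nonneg by (intro sum_le_suminf) auto
    finally show "1 \<le> suminf p + e" by simp
  qed
  ultimately have "p sums 1" using sm by (simp add: sums_iff)
  then show ?thesis using p_nonneg by (simp add: prob_vector_def)
qed

context cylinder_system
begin

text \<open>A maximizing sequence has uniformly bounded means of \<open>- ln (L [i])\<close>, so it is tight and converges
  along a subsequence to a probability vector \<open>p\<close>. Every \<open>t\<close> below the supremum is eventually below the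
  dimensions along the sequence; dominance at \<open>t\<close> passes to the limit, and gives back a lower bound
  for the dimension of \<open>p\<close>.\<close>

theorem dimension_maximizer_exists:
  assumes s: "0 < s" and sm: "summable (\<lambda>i. L [i] powr s)"
    and p0: "prob_vector p0" "ereal s < measure_dim (distr (bernoulli_measure p0) borel code)"
  shows "\<exists>p'. prob_vector p' \<and> (\<forall>p. prob_vector p \<longrightarrow>
    measure_dim (distr (bernoulli_measure p) borel code) \<le> measure_dim (distr (bernoulli_measure p') borel code))"
proof -
  define dim where "dim p = measure_dim (distr (bernoulli_measure p) borel code)" for p
  define D where "D = Sup (dim ` Collect prob_vector)"
  have D_upper: "dim p \<le> D" if "prob_vector p" for p
    unfolding D_def using that by (intro Sup_upper) auto
  have "dim ` Collect prob_vector \<noteq> {}" using p0 by auto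
  from Sup_countable_SUP[OF this] obtain f :: "nat \<Rightarrow> ereal"
    where f: "incseq f" "range f \<subseteq> dim ` Collect prob_vector" "D = (SUP i. f i)"
    unfolding D_def by auto
  have "\<exists>q. prob_vector q \<and> dim q = f n" for n
  proof -
    have "f n \<in> dim ` Collect prob_vector" using f(2) by blast
    then show ?thesis by auto
  qed
  then obtain q where q: "\<And>n. prob_vector (q n)" "\<And>n. dim (q n) = f n" by metis
  have gt_ev: "\<exists>N. \<forall>n\<ge>N. ereal t < dim (q n)" if "ereal t < D" for t
  proof -
    have "\<exists>N\<in>UNIV. ereal t < f N" using that unfolding f(3) by (subst (asm) less_SUP_iff)
    then obtain N where "ereal t < f N" by auto
    then show ?thesis using f(1) q(2) by (metis incseqD order_less_le_trans)
  qed
  have Lt: "integrable (count_space (words k)) (\<lambda>w. L w powr t)" if "s \<le> t" for k t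
  proof (rule L_powr_integrable)
    show "0 < t" using s that by simp
    show "summable (\<lambda>i. L [i] powr t)"
      using L_le_1 J_pos that
      by (intro summable_comparison_test'[OF sm, of 0]) (auto intro!: powr_mono' simp: less_imp_le)
  qed
  have dom: "dominates p t k" if "prob_vector p" "s < t" "ereal t < dim p" "k \<ge> 1" for p t k
    using dominates_if_dim_gt[OF that(1) _ that(4) Lt] that s by (simp add: dim_def)
  have "ereal s < D" using p0 D_upper[OF p0(1)] by (simp add: dim_def)
  then obtain t0 where t0: "s < t0" "ereal t0 < D" using ereal_dense2 by (metis ereal_less(2) less_ereal.simps(1))
  obtain N0 where N0: "\<And>n. n \<ge> N0 \<Longrightarrow> ereal t0 < dim (q n)" using gt_ev[OF t0(2)] by blast
  define q1 where "q1 n = q (n + N0)" for n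
  have q1: "prob_vector (q1 n)" for n by (simp add: q1_def q)
  define b where "b = ((\<integral>w. (C * L w) powr s \<partial>count_space (words 1)) + (t0 - s) * ln C) / (t0 - s)"
  have tight: "(\<Sum>i\<in>I. q1 n i * - ln (L [i])) \<le> b" if I: "finite I" for I n
  proof -
    interpret bernoulli "q1 n" by unfold_locales (rule q1)
    have "dominates (q1 n) t0 1" using q1 t0 N0 by (intro dom) (auto simp: q1_def)
    note lyap = dominates_lyapunov[OF q1 t0(1) this Lt[OF order_refl]]
    have nonneg: "0 \<le> wmass w * - ln (L w)" for w
      using L_le_1[of w] J_pos[of w] by (intro mult_nonneg_nonneg wmass_nonneg) simp
    let ?F = "(\<lambda>i. [i]) ` I"
    have "(\<Sum>i\<in>I. q1 n i * - ln (L [i])) = (\<Sum>w\<in>?F. wmass w * - ln (L w))"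
      by (subst sum.reindex) (auto simp: inj_on_def word_mass_def)
    also have "\<dots> = (\<integral>w. indicator ?F w * (wmass w * - ln (L w)) \<partial>count_space (words 1))"
    proof -
      have "(\<integral>w. indicator ?F w * (wmass w * - ln (L w)) \<partial>count_space (words 1))
          = (\<Sum>w\<in>?F. indicator ?F w * (wmass w * - ln (L w)))"
        using I by (intro lebesgue_integral_count_space_finite_support[THEN trans] sum.mono_neutral_cong_left)
          (auto simp: indicator_def intro: finite_subset[of _ ?F])
      then show ?thesis by simp
    qed
    also have "\<dots> \<le> (\<integral>w. wmass w * - ln (L w) \<partial>count_space (words 1))"
    proof (rule integral_mono[OF _ lyap(1)])
      show "integrable (count_space (words 1)) (\<lambda>w. indicator ?F w * (wmass w * - ln (L w)))"
      proof -
        have "?F \<in> sets (count_space (words 1))" by auto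
        from integrable_mult_indicator[OF this lyap(1)] show ?thesis by simp
      qed
      show "indicator ?F w * (wmass w * - ln (L w)) \<le> wmass w * - ln (L w)" for w
        using nonneg[of w] by (auto simp: indicator_def)
    qed
    also have "\<dots> \<le> b"
      using lyap(2) t0(1) unfolding b_def by (subst pos_le_divide_eq) (auto simp: mult.commute)
    finally show ?thesis .
  qed
  have q1_bounds: "0 \<le> q1 n i" "q1 n i \<le> 1" for n i
  proof -
    interpret bernoulli "q1 n" by unfold_locales (rule q1)
    show "0 \<le> q1 n i" "q1 n i \<le> 1" by (rule p_nonneg p_le_1)+
  qed
  obtain r p where r: "strict_mono r" and lim: "\<And>i. (\<lambda>n. q1 (r n) i) \<longlonglongrightarrow> p i"
    using bounded_sequence_pointwise_convergent[of q1, OF q1_bounds] by blast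
  have p: "prob_vector p"
  proof (rule prob_vector_limit[of "\<lambda>n. q1 (r n)" p "\<lambda>i. - ln (L [i])" b])
    have "(\<lambda>i. L [i] powr s) \<longlonglongrightarrow> 0" by (rule summable_LIMSEQ_zero[OF sm])
    then have "filterlim (\<lambda>i. L [i] powr s) (at_right 0) sequentially"
      using J_pos by (simp add: filterlim_at less_imp_neq[symmetric])
    then have "filterlim (\<lambda>i. ln (L [i] powr s)) at_bot sequentially"
      by (rule filterlim_compose[OF ln_at_0])
    then have "filterlim (\<lambda>i. - ln (L [i] powr s)) at_top sequentially"
      by (simp add: filterlim_uminus_at_bot)
    then have "filterlim (\<lambda>i. inverse s * - ln (L [i] powr s)) at_top sequentially"
      using s by (intro filterlim_tendsto_pos_mult_at_top[OF tendsto_const]) auto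
    moreover have "inverse s * - ln (L [i] powr s) = - ln (L [i])" for i
      using s J_pos[of "[i]"] by (simp add: ln_powr field_simps)
    ultimately show "filterlim (\<lambda>i. - ln (L [i])) at_top sequentially"
      by (simp only:)
    show "0 \<le> - ln (L [i])" for i using L_le_1[of "[i]"] J_pos[of "[i]"] by simp
  qed (use q1 lim tight in auto)
  have "D \<le> dim p"
  proof (rule dense_le)
    fix x assume "x < D"
    then have "max x (ereal s) < D" using \<open>ereal s < D\<close> by simp
    then obtain t' where t': "max x (ereal s) < ereal t'" "ereal t' < D" using ereal_dense2 by blast
    obtain t where t: "ereal t' < ereal t" "ereal t < D" using ereal_dense2[OF t'(2)] by blast
    have st: "s < t'" "t' < t" using t' t by auto
    obtain N where N: "\<And>n. n \<ge> N \<Longrightarrow> ereal t < dim (q n)" using gt_ev[OF t(2)] by blast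
    have "ereal t' \<le> dim p" unfolding dim_def
    proof (rule measure_dim_ge_if_dominates[OF p, of t' t s])
      fix k :: nat assume k: "k \<ge> 1"
      show "dominates p t k"
      proof (rule dominates_limit[where q = "\<lambda>n. q1 (r (n + N))"])
        show "dominates (q1 (r (n + N))) t k" for n
        proof (rule dom[OF q1 _ _ k])
          have "N \<le> r (n + N) + N0" using seq_suble[OF r, of "n + N"] by simp
          then show "ereal t < dim (q1 (r (n + N)))" using N by (simp add: q1_def)
        qed (use st in simp)
        show "(\<lambda>n. q1 (r (n + N)) i) \<longlonglongrightarrow> p i" for i
          using LIMSEQ_ignore_initial_segment[OF lim] .
      qed (use q1 p st Lt in auto)
    qed (use st s Lt in auto)
    moreover have "x < ereal t'" using t'(1) by simp
    ultimately show "x \<le> dim p" by order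
  qed
  then show ?thesis using p D_upper unfolding dim_def by (meson order_trans)
qed

end

section \<open>Bounded distortion of countable branched systems\<close>

locale branched_system =
  fixes a b :: "nat \<Rightarrow> real" and T :: "real \<Rightarrow> real" and \<kappa> :: real and l :: nat and \<Lambda> :: real
  assumes system: "countable_branched_system a b T"
    and \<kappa>: "0 \<le> \<kappa>"
    and distortion: "x \<in> branch_interval a b n \<Longrightarrow> y \<in> branch_interval a b n \<Longrightarrow> z \<in> branch_interval a b n
      \<Longrightarrow> \<bar>deriv (deriv T) x / (deriv T y * deriv T z)\<bar> \<le> \<kappa>"
    and l: "l \<ge> 1" and \<Lambda>: "\<Lambda> > 1"
    and expanding: "x \<in> {0..1} \<Longrightarrow> x \<in> iterate_domain a b T l \<Longrightarrow> \<Lambda> \<le> \<bar>deriv (T ^^ l) x\<bar>"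
begin

abbreviation "I \<equiv> branch_interval a b"
abbreviation "\<phi> \<equiv> inverse_branch a b T"
abbreviation "\<Phi> \<equiv> inverse_word a b T"

lemma I_subset: "I n \<subseteq> {0<..<1}"
  and ab: "a n < b n"
  and I_disjoint: "disjoint_family I"
  and T_bij: "bij_betw T (I n) {0<..<1}"
  using system by (auto simp: countable_branched_system_def)

lemma I_open: "open (I n)" by (simp add: branch_interval_def)

lemma T_deriv:
  assumes x: "x \<in> I n"
  shows "(T has_real_derivative deriv T x) (at x)"
    and "(deriv T has_real_derivative deriv (deriv T) x) (at x)"
proof -
  have "T differentiable (at x)" "deriv T differentiable (at x)"
    using system x at_within_open[OF x I_open]
    by (auto simp: countable_branched_system_def differentiable_on_def) metis+
  then show "(T has_real_derivative deriv T x) (at x)" "(deriv T has_real_derivative deriv (deriv T) x) (at x)"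
    by (simp_all add: DERIV_deriv_iff_real_differentiable)
qed

lemma I_convex: "convex (I n)" by (simp add: branch_interval_def)

text \<open>Division by zero makes the distortion bound say nothing at a zero of the derivative itself. But if
  \<open>T'\<close> vanishes at \<open>x\<close> and not identically, it takes arbitrarily small nonzero values \<open>c * d\<close>, and the
  bound at these points gives \<open>\<bar>T''\<bar> \<le> \<kappa> * (c * d)\<^sup>2\<close> on the whole branch. Hence \<open>T'' = 0\<close>, so \<open>T'\<close> is constant
  and vanishes identically after all. This contradicts the injectivity of \<open>T\<close> on the branch.\<close>

lemma deriv_T_nonzero:
  assumes x: "x \<in> I n"
  shows "deriv T x \<noteq> 0"
proof
  assume zero: "deriv T x = 0"
  have not_const: "\<not> (\<forall>y\<in>I n. deriv T y = 0)"
  proof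
    assume "\<forall>y\<in>I n. deriv T y = 0"
    then have "(T has_real_derivative 0) (at y within I n)" if "y \<in> I n" for y
      using T_deriv(1)[OF that] that by (metis has_field_derivative_at_within)
    then have "\<exists>c. \<forall>y\<in>I n. T y = c"
      by (rule has_field_derivative_zero_constant[OF I_convex])
    moreover have "(2 * a n + b n) / 3 \<in> I n" "(a n + 2 * b n) / 3 \<in> I n"
      "(2 * a n + b n) / 3 \<noteq> (a n + 2 * b n) / 3"
      using ab[of n] by (auto simp: branch_interval_def field_simps)
    ultimately show False
      using bij_betw_imp_inj_on[OF T_bij[of n]] by (metis inj_onD)
  qed
  then obtain x1 where x1: "x1 \<in> I n" "deriv T x1 \<noteq> 0" by auto
  define d where "d = deriv T x1"
  have conn: "connected (deriv T ` I n)"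
    using T_deriv(2) by (intro connected_continuous_image continuous_at_imp_continuous_on ballI convex_connected I_convex)
      (blast intro: DERIV_isCont)
  have "\<bar>deriv (deriv T) y\<bar> \<le> 0" if y: "y \<in> I n" for y
  proof (rule field_le_epsilon)
    fix e :: real assume e: "0 < e"
    (* makes kappa * (c * d)^2 at most e *)
    define c where "c = min 1 (sqrt (e / (\<kappa> + 1)) / \<bar>d\<bar>)"
    have c: "0 < c" "c \<le> 1" using e \<kappa> x1 by (auto simp: c_def d_def)
    have "c * d \<in> deriv T ` I n"
    proof (cases "0 \<le> d")
      case True
      then have "0 \<le> c * d" "c * d \<le> d" using c mult_right_mono[of c 1 d] by auto
      then show ?thesis using connectedD_interval[OF conn, of 0 d "c * d"] x x1 zero unfolding d_def by (metis imageI)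
    next
      case False
      then have "c * d \<le> 0" "d \<le> c * d" using c mult_right_mono_neg[of c 1 d] by (auto simp: mult_nonneg_nonpos)
      then show ?thesis using connectedD_interval[OF conn, of d 0 "c * d"] x x1 zero unfolding d_def by (metis imageI)
    qed
    then obtain z where z: "z \<in> I n" "deriv T z = c * d" by auto
    have nz: "c * d \<noteq> 0" using c x1 by (simp add: d_def)
    have "\<bar>deriv (deriv T) y\<bar> = \<bar>deriv (deriv T) y / (deriv T z * deriv T z)\<bar> * (c * d)\<^sup>2"
    proof -
      have "(c * d)\<^sup>2 = \<bar>deriv T z * deriv T z\<bar>" by (simp add: z(2) power2_eq_square)
      then show ?thesis using nz z(2) by (simp only: abs_divide) simp
    qed
    also have "\<dots> \<le> \<kappa> * (c * d)\<^sup>2" using distortion[OF y z(1) z(1)] by (intro mult_right_mono) auto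
    also have "\<dots> \<le> \<kappa> * (e / (\<kappa> + 1))"
    proof (rule mult_left_mono)
      have "\<bar>c * d\<bar> \<le> sqrt (e / (\<kappa> + 1)) / \<bar>d\<bar> * \<bar>d\<bar>"
        using c unfolding abs_mult c_def by (intro mult_right_mono) auto
      then have "\<bar>c * d\<bar> \<le> sqrt (e / (\<kappa> + 1))" using x1 by (simp add: d_def)
      then have "\<bar>c * d\<bar>\<^sup>2 \<le> (sqrt (e / (\<kappa> + 1)))\<^sup>2" by (rule power_mono) simp
      then show "(c * d)\<^sup>2 \<le> e / (\<kappa> + 1)" using e \<kappa> by simp
    qed (rule \<kappa>)
    also have "\<dots> \<le> e" using e \<kappa> by (simp add: field_simps)
    finally show "\<bar>deriv (deriv T) y\<bar> \<le> 0 + e" by simp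
  qed
  then have "(deriv T has_real_derivative 0) (at y within I n)" if "y \<in> I n" for y
    using T_deriv(2)[OF that] that by (metis abs_le_zero_iff has_field_derivative_at_within)
  then have "\<exists>c. \<forall>y\<in>I n. deriv T y = c"
    by (rule has_field_derivative_zero_constant[OF I_convex])
  then show False using x x1 zero by auto
qed

lemma \<phi>_mem: "y \<in> {0<..<1} \<Longrightarrow> \<phi> n y \<in> I n"
  and T_\<phi>: "y \<in> {0<..<1} \<Longrightarrow> T (\<phi> n y) = y"
  and \<phi>_T: "x \<in> I n \<Longrightarrow> \<phi> n (T x) = x"
  unfolding inverse_branch_def using T_bij[of n]
  by (auto simp: bij_betw_def the_inv_into_into f_the_inv_into_f the_inv_into_f_f)

lemma \<phi>_deriv:
  assumes y: "y \<in> {0<..<1}"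
  shows "(\<phi> n has_real_derivative inverse (deriv T (\<phi> n y))) (at y)"
proof -
  have "isCont T x" if "x \<in> I n" for x using T_deriv(1)[OF that] by (rule DERIV_isCont)
  then have contT: "continuous_on (I n) T" by (intro continuous_at_imp_continuous_on) blast
  have "(\<phi> n has_derivative (\<lambda>h. inverse (deriv T (\<phi> n y)) * h)) (at y)"
  proof (rule has_derivative_inverse_strong_x[where f = T and S = "I n" and f' = "\<lambda>h. deriv T (\<phi> n y) * h"])
    show "(\<lambda>h. deriv T (\<phi> n y) * h) \<circ> (\<lambda>h. inverse (deriv T (\<phi> n y)) * h) = id"
      using deriv_T_nonzero[OF \<phi>_mem[OF y]] by (auto simp: fun_eq_iff)
    show "(T has_derivative (\<lambda>h. deriv T (\<phi> n y) * h)) (at (\<phi> n y))"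
      using T_deriv(1)[OF \<phi>_mem[OF y]] by (simp add: has_field_derivative_def)
  qed (use y \<phi>_mem T_\<phi> \<phi>_T I_open contT in auto)
  then show ?thesis by (simp add: has_field_derivative_def)
qed

text \<open>The generalized mean value theorem compares \<open>ln \<bar>T'\<bar>\<close> with \<open>T\<close> itself; the quotient of their derivatives
  is \<open>T'' / (T' * T')\<close>, which is bounded by \<open>\<kappa>\<close>.\<close>

lemma deriv_T_distortion:
  assumes x: "x \<in> I n" and y: "y \<in> I n"
  shows "\<bar>deriv T y\<bar> \<le> exp (\<kappa> * \<bar>T x - T y\<bar>) * \<bar>deriv T x\<bar>"
proof -
  (* ln of the absolute value of the derivative, written without a case distinction on its sign *)
  define g where "g x = ln ((deriv T x)\<^sup>2) / 2" for x
  have g: "g z = ln \<bar>deriv T z\<bar>" if "z \<in> I n" for z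
    using deriv_T_nonzero[OF that] ln_realpow[of "\<bar>deriv T z\<bar>" 2] by (simp add: g_def)
  have g_deriv: "(g has_real_derivative deriv (deriv T) z / deriv T z) (at z)" if z: "z \<in> I n" for z
  proof -
    have "0 < deriv T z * deriv T z"
      using deriv_T_nonzero[OF z] by (metis not_real_square_gt_zero)
    then show ?thesis
      unfolding g_def using deriv_T_nonzero[OF z]
      by (auto intro!: derivative_eq_intros T_deriv(2)[OF z] simp: power2_eq_square field_simps)
  qed
  have key: "\<bar>g v - g u\<bar> \<le> \<kappa> * \<bar>T v - T u\<bar>" if uv: "u \<in> I n" "v \<in> I n" "u < v" for u v
  proof -
    have sub: "z \<in> I n" if "u \<le> z" "z \<le> v" for z using uv that by (auto simp: branch_interval_def)
    have "\<exists>c>u. c < v \<and> (T v - T u) * (deriv (deriv T) c / deriv T c) = (g v - g u) * deriv T c"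
      using sub by (intro GMVT'[OF uv(3)] DERIV_isCont[OF T_deriv(1)] DERIV_isCont[OF g_deriv]
          T_deriv(1)[where n = n] g_deriv) auto
    then obtain c where c: "u < c" "c < v"
      "(T v - T u) * (deriv (deriv T) c / deriv T c) = (g v - g u) * deriv T c" by blast
    have cI: "c \<in> I n" using sub c by auto
    have "g v - g u = (T v - T u) * (deriv (deriv T) c / (deriv T c * deriv T c))"
      using c(3) deriv_T_nonzero[OF cI] by (simp add: field_simps)
    then have "\<bar>g v - g u\<bar> = \<bar>T v - T u\<bar> * \<bar>deriv (deriv T) c / (deriv T c * deriv T c)\<bar>"
      by (simp only: abs_mult)
    also have "\<dots> \<le> \<bar>T v - T u\<bar> * \<kappa>" by (intro mult_left_mono distortion[OF cI cI cI]) auto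
    finally show ?thesis by (simp add: mult.commute)
  qed
  have "\<bar>g y - g x\<bar> \<le> \<kappa> * \<bar>T x - T y\<bar>"
    using key[OF x y] key[OF y x] by (cases x y rule: linorder_cases) (auto simp: abs_minus_commute)
  then have "ln \<bar>deriv T y\<bar> \<le> \<kappa> * \<bar>T x - T y\<bar> + ln \<bar>deriv T x\<bar>"
    using g[OF x] g[OF y] by linarith
  then have "exp (ln \<bar>deriv T y\<bar>) \<le> exp (\<kappa> * \<bar>T x - T y\<bar> + ln \<bar>deriv T x\<bar>)" by simp
  then show ?thesis
    using deriv_T_nonzero[OF x] deriv_T_nonzero[OF y] by (simp add: exp_add)
qed

lemma \<Phi>_append: "\<Phi> (u @ v) = \<Phi> u \<circ> \<Phi> v"
  by (induction u) auto

lemma \<Phi>_mem: "y \<in> {0<..<1} \<Longrightarrow> \<Phi> w y \<in> {0<..<1}"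
proof (induction w)
  case (Cons i w) then show ?case using \<phi>_mem[of "\<Phi> w y" i] I_subset[of i] by auto
qed auto

lemma \<Phi>_deriv_aux:
  assumes y: "y \<in> {0<..<1}"
  shows "\<exists>d. d \<noteq> 0 \<and> (\<Phi> w has_real_derivative d) (at y)"
proof (induction w)
  case Nil show ?case by (intro exI[of _ 1]) (auto simp: id_def)
next
  case (Cons i w)
  then obtain d where d: "d \<noteq> 0" "(\<Phi> w has_real_derivative d) (at y)" by auto
  have "inverse (deriv T (\<phi> i (\<Phi> w y))) * d \<noteq> 0"
    using d(1) deriv_T_nonzero[OF \<phi>_mem[OF \<Phi>_mem[OF y]]] by simp
  then show ?case
    using DERIV_chain[OF \<phi>_deriv[OF \<Phi>_mem[OF y]] d(2)] by (metis inverse_word.simps(2))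
qed

lemma \<Phi>_deriv: "y \<in> {0<..<1} \<Longrightarrow> (\<Phi> w has_real_derivative deriv (\<Phi> w) y) (at y)"
  and deriv_\<Phi>_nonzero: "y \<in> {0<..<1} \<Longrightarrow> deriv (\<Phi> w) y \<noteq> 0"
  using \<Phi>_deriv_aux[of y w] DERIV_imp_deriv by metis+

lemma deriv_\<Phi>_Cons:
  assumes y: "y \<in> {0<..<1}"
  shows "deriv (\<Phi> (i # w)) y = inverse (deriv T (\<phi> i (\<Phi> w y))) * deriv (\<Phi> w) y"
  using DERIV_chain[OF \<phi>_deriv[OF \<Phi>_mem[OF y]] \<Phi>_deriv[OF y]] by (intro DERIV_imp_deriv) auto

lemma \<Phi>_mvt:
  assumes x: "x \<in> {0<..<1}" and y: "y \<in> {0<..<1}"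
  shows "\<exists>z\<in>{0<..<1}. \<bar>\<Phi> w x - \<Phi> w y\<bar> = \<bar>deriv (\<Phi> w) z\<bar> * \<bar>x - y\<bar>"
proof -
  have *: "\<exists>z\<in>{0<..<1}. \<bar>\<Phi> w v - \<Phi> w u\<bar> = \<bar>deriv (\<Phi> w) z\<bar> * \<bar>v - u\<bar>"
    if uv: "u \<in> {0<..<1}" "v \<in> {0<..<1}" "u < v" for u v
  proof -
    have "\<And>z. u \<le> z \<Longrightarrow> z \<le> v \<Longrightarrow> (\<Phi> w has_real_derivative deriv (\<Phi> w) z) (at z)"
      using uv by (intro \<Phi>_deriv) auto
    from MVT2[OF uv(3) this] obtain z where "u < z" "z < v" "\<Phi> w v - \<Phi> w u = (v - u) * deriv (\<Phi> w) z"
      by blast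
    then show ?thesis using uv by (intro bexI[of _ z]) (auto simp: abs_mult)
  qed
  show ?thesis
  proof (cases x y rule: linorder_cases)
    case equal then show ?thesis using x by auto
  next
    case less then show ?thesis using *[OF x y] by (simp add: abs_minus_commute)
  next
    case greater then show ?thesis using *[OF y x] by simp
  qed
qed

lemma funpow_\<Phi>:
  "y \<in> {0<..<1} \<Longrightarrow> j \<le> length w \<Longrightarrow> (T ^^ j) (\<Phi> w y) = \<Phi> (drop j w) y"
proof (induction j arbitrary: w)
  case (Suc j)
  then obtain i v where w: "w = i # v" by (cases w) auto
  have "T (\<Phi> w y) = \<Phi> v y" using T_\<phi>[OF \<Phi>_mem[OF Suc.prems(1)]] by (simp add: w)
  then show ?case using Suc.IH[OF Suc.prems(1), of v] Suc.prems(2)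
    by (simp add: w funpow_Suc_right del: funpow.simps)
qed simp

lemma \<Phi>_iterate_domain:
  assumes y: "y \<in> {0<..<1}"
  shows "\<Phi> w y \<in> iterate_domain a b T (length w)"
  unfolding iterate_domain_def
proof (intro CollectI allI impI)
  fix j assume j: "j < length w"
  then obtain i v where v: "drop j w = i # v" by (metis Cons_nth_drop_Suc)
  show "(T ^^ j) (\<Phi> w y) \<in> branch_domain a b"
    using funpow_\<Phi>[OF y, of j w] j v \<phi>_mem[OF \<Phi>_mem[OF y]] by (auto simp: branch_domain_def)
qed

lemma funpow_deriv:
  assumes y: "y \<in> {0<..<1}"
  shows "(T ^^ length w has_real_derivative inverse (deriv (\<Phi> w) y)) (at (\<Phi> w y))"
proof (induction w)
  case Nil
  have "deriv (\<Phi> []) y = 1" by (intro DERIV_imp_deriv) (auto simp: id_def)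
  then show ?case by (simp add: id_def)
next
  case (Cons i w)
  have m: "\<Phi> (i # w) y \<in> I i" using \<phi>_mem[OF \<Phi>_mem[OF y]] by simp
  have "T (\<Phi> (i # w) y) = \<Phi> w y" using T_\<phi>[OF \<Phi>_mem[OF y]] by simp
  then have "(T ^^ length w \<circ> T has_real_derivative inverse (deriv (\<Phi> w) y) * deriv T (\<Phi> (i # w) y)) (at (\<Phi> (i # w) y))"
    using Cons T_deriv(1)[OF m] by (intro DERIV_chain) auto
  moreover have "inverse (deriv (\<Phi> w) y) * deriv T (\<Phi> (i # w) y) = inverse (deriv (\<Phi> (i # w)) y)"
    by (simp add: deriv_\<Phi>_Cons[OF y] del: inverse_word.simps) (simp add: mult.commute)
  moreover have "T ^^ length (i # w) = T ^^ length w \<circ> T" by (simp only: list.size(4) add_Suc_right add_0_right funpow_Suc_right)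
  ultimately show ?case by (simp only:)
qed

text \<open>\<open>T ^^ l\<close> inverts \<open>\<Phi> w\<close>, so expansion of the iterate bounds the derivative of \<open>\<Phi> w\<close>. The points of the
  cylinder all lie in the domain of the iterate.\<close>

lemma \<Phi>_contracts:
  assumes w: "length w = l" and x: "x \<in> {0<..<1}" and y: "y \<in> {0<..<1}"
  shows "\<bar>\<Phi> w x - \<Phi> w y\<bar> \<le> (1 / \<Lambda>) * \<bar>x - y\<bar>"
proof -
  obtain z where z: "z \<in> {0<..<1}" "\<bar>\<Phi> w x - \<Phi> w y\<bar> = \<bar>deriv (\<Phi> w) z\<bar> * \<bar>x - y\<bar>"
    using \<Phi>_mvt[OF x y] by blast
  have "deriv (T ^^ l) (\<Phi> w z) = inverse (deriv (\<Phi> w) z)"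
    using funpow_deriv[OF z(1), of w] w by (intro DERIV_imp_deriv) auto
  moreover have "\<Lambda> \<le> \<bar>deriv (T ^^ l) (\<Phi> w z)\<bar>"
    using \<Phi>_mem[OF z(1), of w] \<Phi>_iterate_domain[OF z(1), of w] w by (intro expanding) auto
  ultimately have "\<Lambda> \<le> inverse \<bar>deriv (\<Phi> w) z\<bar>" by (simp add: abs_inverse)
  then have "\<bar>deriv (\<Phi> w) z\<bar> \<le> 1 / \<Lambda>"
    using deriv_\<Phi>_nonzero[OF z(1), of w] \<Lambda> by (simp add: field_simps)
  then show ?thesis unfolding z(2) by (rule mult_right_mono) simp
qed

lemma \<Phi>_dist_le:
  assumes x: "x \<in> {0<..<1}" and y: "y \<in> {0<..<1}"
  shows "\<bar>\<Phi> w x - \<Phi> w y\<bar> \<le> (1 / \<Lambda>) ^ (length w div l)"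
proof (induction "length w" arbitrary: w rule: less_induct)
  case less
  show ?case
  proof (cases "length w < l")
    case True
    then show ?thesis using \<Phi>_mem[OF x, of w] \<Phi>_mem[OF y, of w] by auto
  next
    case False
    define v where "v = drop l w"
    have "length w div l = Suc (length v div l)"
      using False l by (simp add: v_def le_div_geq)
    moreover have "\<Phi> w = \<Phi> (take l w) \<circ> \<Phi> v" by (simp add: v_def \<Phi>_append[symmetric])
    moreover have "\<bar>\<Phi> (take l w) (\<Phi> v x) - \<Phi> (take l w) (\<Phi> v y)\<bar> \<le> (1 / \<Lambda>) * \<bar>\<Phi> v x - \<Phi> v y\<bar>"
      using False by (intro \<Phi>_contracts \<Phi>_mem x y) auto
    moreover have "(1 / \<Lambda>) * \<bar>\<Phi> v x - \<Phi> v y\<bar> \<le> (1 / \<Lambda>) * (1 / \<Lambda>) ^ (length v div l)"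
      using False l \<Lambda> by (intro mult_left_mono less) (auto simp: v_def)
    ultimately show ?thesis by simp
  qed
qed

text \<open>The rate per symbol that corresponds to contraction by \<open>1 / \<Lambda>\<close> over \<open>l\<close> symbols.\<close>

definition \<rho> :: real where "\<rho> = (1 / \<Lambda>) powr (1 / real l)"

lemma \<rho>: "0 < \<rho>" "\<rho> < 1"
  using \<Lambda> l powr_less_mono2[of "1 / real l" "1 / \<Lambda>" 1] by (auto simp: \<rho>_def)

lemma \<Phi>_dist_decay:
  assumes x: "x \<in> {0<..<1}" and y: "y \<in> {0<..<1}"
  shows "\<bar>\<Phi> w x - \<Phi> w y\<bar> \<le> \<Lambda> * \<rho> ^ length w"
proof -
  let ?n = "length w"
  have "real ?n / real l \<le> real (?n div l) + 1"
  proof -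
    have "?n < (?n div l + 1) * l" using l by (simp add: dividend_less_div_times add.commute)
    then have "real ?n \<le> real ((?n div l + 1) * l)" by linarith
    then show ?thesis using l by (simp add: field_simps)
  qed
  have "(1 / \<Lambda>) ^ (?n div l) = (1 / \<Lambda>) powr real (?n div l)"
    using \<Lambda> by (simp add: powr_realpow)
  also have "\<dots> \<le> (1 / \<Lambda>) powr (real ?n / real l - 1)"
    using \<Lambda> \<open>real ?n / real l \<le> _\<close> by (intro powr_mono') auto
  also have "\<dots> = \<Lambda> * (1 / \<Lambda>) powr (real ?n / real l)"
    using \<Lambda> by (simp add: powr_diff)
  also have "(1 / \<Lambda>) powr (real ?n / real l) = \<rho> ^ ?n"
    using \<Lambda> unfolding \<rho>_def by (subst powr_realpow[symmetric]) (auto simp: powr_powr)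
  finally show ?thesis using \<Phi>_dist_le[OF x y, of w] by linarith
qed

definition C :: real where "C = exp (\<kappa> * (\<Lambda> / (1 - \<rho>)))"

text \<open>Each symbol contributes a factor \<open>exp (\<kappa> * d)\<close> with \<open>d\<close> the length of the cylinder of the remaining
  word. These lengths decay geometrically, so the product is bounded independently of the word.\<close>

lemma deriv_\<Phi>_distortion:
  assumes x: "x \<in> {0<..<1}" and y: "y \<in> {0<..<1}"
  shows "\<bar>deriv (\<Phi> w) x\<bar> \<le> C * \<bar>deriv (\<Phi> w) y\<bar>"
proof -
  have step: "\<bar>deriv (\<Phi> w) x\<bar> \<le> exp (\<kappa> * (\<Sum>j<length w. \<Lambda> * \<rho> ^ j)) * \<bar>deriv (\<Phi> w) y\<bar>"
  proof (induction w)
    case Nil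
    have "deriv (\<Phi> []) z = 1" for z by (intro DERIV_imp_deriv) (auto simp: id_def)
    then show ?case by simp
  next
    case (Cons i w)
    let ?u = "\<phi> i (\<Phi> w x)" and ?v = "\<phi> i (\<Phi> w y)"
    have uv: "?u \<in> I i" "?v \<in> I i" using \<phi>_mem \<Phi>_mem x y by auto
    have T: "T ?u = \<Phi> w x" "T ?v = \<Phi> w y" using T_\<phi> \<Phi>_mem x y by auto
    have "\<bar>deriv T ?v\<bar> \<le> exp (\<kappa> * \<bar>\<Phi> w x - \<Phi> w y\<bar>) * \<bar>deriv T ?u\<bar>"
      using deriv_T_distortion[OF uv] T by simp
    also have "\<dots> \<le> exp (\<kappa> * (\<Lambda> * \<rho> ^ length w)) * \<bar>deriv T ?u\<bar>"
      using \<Phi>_dist_decay[OF x y] \<kappa> by (intro mult_right_mono) (auto intro: mult_left_mono)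
    finally have A: "inverse \<bar>deriv T ?u\<bar> \<le> exp (\<kappa> * (\<Lambda> * \<rho> ^ length w)) * inverse \<bar>deriv T ?v\<bar>"
      using deriv_T_nonzero[OF uv(1)] deriv_T_nonzero[OF uv(2)] by (simp add: field_simps)
    have "\<bar>deriv (\<Phi> (i # w)) x\<bar> = inverse \<bar>deriv T ?u\<bar> * \<bar>deriv (\<Phi> w) x\<bar>"
      by (simp add: deriv_\<Phi>_Cons[OF x] abs_mult abs_inverse del: inverse_word.simps)
    also have "\<dots> \<le> (exp (\<kappa> * (\<Lambda> * \<rho> ^ length w)) * inverse \<bar>deriv T ?v\<bar>) *
        (exp (\<kappa> * (\<Sum>j<length w. \<Lambda> * \<rho> ^ j)) * \<bar>deriv (\<Phi> w) y\<bar>)"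
      by (intro mult_mono A Cons) auto
    also have "\<dots> = exp (\<kappa> * (\<Sum>j<length (i # w). \<Lambda> * \<rho> ^ j)) * \<bar>deriv (\<Phi> (i # w)) y\<bar>"
      by (simp add: deriv_\<Phi>_Cons[OF y] abs_mult abs_inverse exp_add distrib_left del: inverse_word.simps)
    finally show ?case .
  qed
  have "(\<Sum>j<length w. \<rho> ^ j) \<le> 1 / (1 - \<rho>)"
    using sum_le_suminf[OF summable_geometric[of \<rho>], of "{..<length w}"] suminf_geometric[of \<rho>] \<rho> by simp
  then have "\<Lambda> * (\<Sum>j<length w. \<rho> ^ j) \<le> \<Lambda> * (1 / (1 - \<rho>))" using \<Lambda> by (intro mult_left_mono) auto
  then have "\<Lambda> * (\<Sum>j<length w. \<rho> ^ j) \<le> \<Lambda> / (1 - \<rho>)" by simp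
  from mult_left_mono[OF this \<kappa>] have "exp (\<kappa> * (\<Sum>j<length w. \<Lambda> * \<rho> ^ j)) \<le> C"
    by (simp only: C_def sum_distrib_left[symmetric] exp_le_cancel_iff)
  then have "exp (\<kappa> * (\<Sum>j<length w. \<Lambda> * \<rho> ^ j)) * \<bar>deriv (\<Phi> w) y\<bar> \<le> C * \<bar>deriv (\<Phi> w) y\<bar>"
    by (rule mult_right_mono) simp
  then show ?thesis using step by linarith
qed

text \<open>A form of bounded distortion without derivatives: taking \<open>u\<close>, \<open>v\<close> close to the ends of the unit
  interval, or \<open>x\<close>, \<open>y\<close>, gives both halves of the quasi-multiplicativity of cylinder lengths.\<close>

lemma \<Phi>_dist_distortion:
  assumes x: "x \<in> {0<..<1}" "y \<in> {0<..<1}" and u: "u \<in> {0<..<1}" "v \<in> {0<..<1}"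
  shows "\<bar>\<Phi> w x - \<Phi> w y\<bar> * \<bar>u - v\<bar> \<le> C * \<bar>\<Phi> w u - \<Phi> w v\<bar> * \<bar>x - y\<bar>"
proof -
  obtain z1 where z1: "z1 \<in> {0<..<1}" "\<bar>\<Phi> w x - \<Phi> w y\<bar> = \<bar>deriv (\<Phi> w) z1\<bar> * \<bar>x - y\<bar>"
    using \<Phi>_mvt[OF x] by blast
  obtain z2 where z2: "z2 \<in> {0<..<1}" "\<bar>\<Phi> w u - \<Phi> w v\<bar> = \<bar>deriv (\<Phi> w) z2\<bar> * \<bar>u - v\<bar>"
    using \<Phi>_mvt[OF u] by blast
  have "\<bar>deriv (\<Phi> w) z1\<bar> * (\<bar>x - y\<bar> * \<bar>u - v\<bar>) \<le> C * \<bar>deriv (\<Phi> w) z2\<bar> * (\<bar>x - y\<bar> * \<bar>u - v\<bar>)"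
    by (intro mult_right_mono deriv_\<Phi>_distortion z1 z2) auto
  then show ?thesis unfolding z1(2) z2(2) by (simp add: mult_ac)
qed

abbreviation "J \<equiv> cylinder_interval a b T"

lemma \<Phi>_inj:
  assumes "length u = length v" "x \<in> {0<..<1}" "y \<in> {0<..<1}" "\<Phi> u x = \<Phi> v y"
  shows "u = v \<and> x = y"
  using assms
proof (induction u v rule: list_induct2)
  case (Cons i u j v)
  have *: "\<phi> i (\<Phi> u x) \<in> I i" "\<phi> j (\<Phi> v y) \<in> I j" 
    by (intro \<phi>_mem \<Phi>_mem Cons.prems)+
  then have ij: "i = j" using I_disjoint Cons.prems(3) unfolding disjoint_family_on_def by fastforce
  have "\<Phi> u x = \<Phi> v y" 
    using arg_cong[OF Cons.prems(3), of T]
      T_\<phi>[OF \<Phi>_mem[OF Cons.prems(1), of u], of i] T_\<phi>[OF \<Phi>_mem[OF Cons.prems(2), of v], of j] by simp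
  then show ?case using Cons ij by simp
qed simp

lemma J_sub: "J w \<subseteq> {0<..<1}"
  unfolding cylinder_interval_def using \<Phi>_mem by blast

lemma J_dist: "x \<in> {0<..<1} \<Longrightarrow> y \<in> {0<..<1} \<Longrightarrow> \<bar>\<Phi> w x - \<Phi> w y\<bar> \<le> diameter (J w)"
  using diameter_bounded_bound[of "J w" "\<Phi> w x" "\<Phi> w y"] bounded_subset[OF _ J_sub]
  by (auto simp: cylinder_interval_def dist_real_def)

lemma diameter_J_le:
  assumes "\<And>x y. x \<in> {0<..<1} \<Longrightarrow> y \<in> {0<..<1} \<Longrightarrow> \<bar>\<Phi> w x - \<Phi> w y\<bar> \<le> d"
  shows "diameter (J w) \<le> d"
proof (rule diameter_le)
  have "(1/2::real) \<in> {0<..<1}" by simp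
  then show "J w \<noteq> {} \<or> 0 \<le> d" unfolding cylinder_interval_def by blast
qed (use assms in \<open>auto simp: cylinder_interval_def\<close>)

lemma cylinder_system: "cylinder_system J C \<Lambda> \<rho>"
proof
  show "convex (J w)" for w
  proof -
    have "isCont (\<Phi> w) y" if "y \<in> {0<..<1}" for y using \<Phi>_deriv[OF that] by (rule DERIV_isCont)
    then have "connected (J w)" unfolding cylinder_interval_def
      by (intro connected_continuous_image continuous_at_imp_continuous_on ballI) auto
    then show ?thesis by (simp add: is_interval_convex_1[symmetric] is_interval_connected_1)
  qed
  show "bounded (J w)" for w by (rule bounded_subset[OF _ J_sub]) simp
  show "J u \<inter> J v = {}" if "length u = length v" "u \<noteq> v" for u v
    unfolding cylinder_interval_def using \<Phi>_inj[OF that(1)] that(2) by blast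
  show "J (u @ v) \<subseteq> J u" for u v
    unfolding cylinder_interval_def \<Phi>_append using \<Phi>_mem[of _ v] by auto
  show pos: "0 < diameter (J w)" for w
  proof -
    have "\<Phi> w (1/3) \<noteq> \<Phi> w (2/3)" using \<Phi>_inj[of w w "1/3" "2/3"] by auto
    then show ?thesis using J_dist[of "1/3" "2/3" w] by simp
  qed
  show "diameter (J []) = 1" by (simp add: cylinder_interval_def)
  show "1 \<le> C" unfolding C_def using \<kappa> \<Lambda> \<rho> by simp
  have C0: "0 < C" by (simp add: C_def)
  show "diameter (J (u @ v)) \<le> C * (diameter (J u) * diameter (J v))" for u v
  proof (rule diameter_J_le)
    fix x y :: real assume xy: "x \<in> {0<..<1}" "y \<in> {0<..<1}"
    show "\<bar>\<Phi> (u @ v) x - \<Phi> (u @ v) y\<bar> \<le> C * (diameter (J u) * diameter (J v))"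
    proof (rule field_le_mult_one_interval)
      fix r :: real assume r: "0 < r" "r < 1"
      let ?s = "(1 - r) / 2" and ?t = "(1 + r) / 2"
      have st: "?s \<in> {0<..<1}" "?t \<in> {0<..<1}" "\<bar>?s - ?t\<bar> = r" using r by (auto simp: field_simps abs_if)
      have "r * \<bar>\<Phi> (u @ v) x - \<Phi> (u @ v) y\<bar> = \<bar>\<Phi> u (\<Phi> v x) - \<Phi> u (\<Phi> v y)\<bar> * \<bar>?s - ?t\<bar>"
        unfolding \<Phi>_append st(3) by simp
      also have "\<dots> \<le> C * \<bar>\<Phi> u ?s - \<Phi> u ?t\<bar> * \<bar>\<Phi> v x - \<Phi> v y\<bar>"
        using xy st by (intro \<Phi>_dist_distortion \<Phi>_mem)
      also have "\<dots> \<le> C * diameter (J u) * diameter (J v)"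
        using xy st C0 pos by (intro mult_mono J_dist) (auto simp: less_imp_le)
      finally show "r * \<bar>\<Phi> (u @ v) x - \<Phi> (u @ v) y\<bar> \<le> C * (diameter (J u) * diameter (J v))"
        by (simp add: mult.assoc)
    qed
  qed
  show "diameter (J u) * diameter (J v) \<le> C * diameter (J (u @ v))" for u v
  proof -
    have A: "\<bar>\<Phi> u x - \<Phi> u y\<bar> * \<bar>\<Phi> v x' - \<Phi> v y'\<bar> \<le> C * diameter (J (u @ v))"
      if xy: "x \<in> {0<..<1}" "y \<in> {0<..<1}" "x' \<in> {0<..<1}" "y' \<in> {0<..<1}" for x y x' y'
    proof -
      have "\<bar>\<Phi> u x - \<Phi> u y\<bar> * \<bar>\<Phi> v x' - \<Phi> v y'\<bar> \<le> C * \<bar>\<Phi> u (\<Phi> v x') - \<Phi> u (\<Phi> v y')\<bar> * \<bar>x - y\<bar>"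
        using xy by (intro \<Phi>_dist_distortion \<Phi>_mem)
      also have "\<dots> \<le> C * diameter (J (u @ v)) * 1"
        using J_dist[OF xy(3,4), of "u @ v"] xy C0 pos[of "u @ v"] by (intro mult_mono) (auto simp: \<Phi>_append less_imp_le)
      finally show ?thesis by simp
    qed
    have B: "\<bar>\<Phi> u x - \<Phi> u y\<bar> \<le> C * diameter (J (u @ v)) / diameter (J v)"
      if xy: "x \<in> {0<..<1}" "y \<in> {0<..<1}" for x y
    proof (cases "\<Phi> u x = \<Phi> u y")
      case True then show ?thesis using C0 pos by (simp add: less_imp_le)
    next
      case False
      then have p: "0 < \<bar>\<Phi> u x - \<Phi> u y\<bar>" by simp
      have "diameter (J v) \<le> C * diameter (J (u @ v)) / \<bar>\<Phi> u x - \<Phi> u y\<bar>"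
        by (rule diameter_J_le, subst pos_le_divide_eq[OF p], subst mult.commute) (rule A[OF xy])
      then show ?thesis using p pos[of v] by (simp add: field_simps)
    qed
    have "diameter (J u) \<le> C * diameter (J (u @ v)) / diameter (J v)"
      by (rule diameter_J_le) (rule B)
    then show ?thesis using pos[of v] by (simp add: field_simps)
  qed
  show "0 < \<rho>" "\<rho> < 1" by (rule \<rho>)+
  show "0 < \<Lambda>" using \<Lambda> by simp
  show "diameter (J w) \<le> \<Lambda> * \<rho> ^ length w" for w
    by (rule diameter_J_le) (rule \<Phi>_dist_decay)
qed

sublocale cylinder_system J C \<Lambda> \<rho> by (rule cylinder_system)

lemma diameter_J_single: "diameter (J [i]) = b i - a i"
proof -
  have "J [i] = I i"
  proof
    show "J [i] \<subseteq> I i" unfolding cylinder_interval_def using \<phi>_mem[of _ i] by auto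
    show "I i \<subseteq> J [i]"
    proof
      fix x assume x: "x \<in> I i"
      have "T x \<in> {0<..<1}" using bij_betwE[OF T_bij[of i]] x by blast
      then have "\<Phi> [i] (T x) \<in> J [i]" unfolding cylinder_interval_def by (rule imageI)
      then show "x \<in> J [i]" using \<phi>_T[OF x] by simp
    qed
  qed
  then show ?thesis using ab[of i] by (simp add: branch_interval_def)
qed

lemma coding_map_eq_code: "coding_map a b T = code"
  by (rule ext) (simp add: coding_map_def code_def)

end

section \<open>The dimension maximizing measure\<close>

theorem theorem2p1:
  fixes a b :: "nat \<Rightarrow> real" and T :: "real \<Rightarrow> real"
  assumes "countable_branched_system a b T"
    and "monotone_derivative a b T"
    and "second_iterate_condition a b T"
    and "eventually_expanding a b T"
    and "bounded_distortion a b T"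
    and "\<exists>s\<in>{0<..<1}. summable_lengths a b s"
    and "\<exists>p. prob_vector p \<and> measure_dim (coded_measure a b T p) > ereal (critical_exponent a b)"
  shows "\<exists>p'. prob_vector p' \<and>
           (SUP p\<in>{p. prob_vector p}. measure_dim (coded_measure a b T p))
             = measure_dim (coded_measure a b T p')"
proof -
  obtain l \<Lambda> where l: "l \<ge> 1" "\<Lambda> > 1" "\<And>x. x \<in> {0..1} \<Longrightarrow> x \<in> iterate_domain a b T l \<Longrightarrow> \<Lambda> \<le> \<bar>deriv (T ^^ l) x\<bar>"
    using assms(4) unfolding eventually_expanding_def by auto
  obtain \<kappa> where \<kappa>: "\<And>n x y z. x \<in> branch_interval a b n \<Longrightarrow> y \<in> branch_interval a b n \<Longrightarrow> z \<in> branch_interval a b n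
      \<Longrightarrow> \<bar>deriv (deriv T) x / (deriv T y * deriv T z)\<bar> \<le> \<kappa>"
    using assms(5) unfolding bounded_distortion_def by metis
  interpret branched_system a b T "max \<kappa> 0" l \<Lambda>
    using assms(1) l \<kappa> by unfold_locales (auto simp: le_max_iff_disj)
  obtain p0 where p0: "prob_vector p0" "ereal (critical_exponent a b) < measure_dim (coded_measure a b T p0)"
    using assms(7) by auto
  obtain r where r: "critical_exponent a b < r" "ereal r < measure_dim (coded_measure a b T p0)"
    using ereal_dense2[OF p0(2)] by auto
  obtain s where s: "summable_lengths a b s" "s < r"
    using assms(6) r(1) cInf_lessD[of "{s. summable_lengths a b s}" r] unfolding critical_exponent_def by auto
  have sm: "summable (\<lambda>i. L [i] powr s)"
    using s(1) by (simp add: summable_lengths_def diameter_J_single)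
  have s0: "0 < s"
  proof (rule ccontr)
    assume "\<not> 0 < s"
    then have "1 \<le> L [i] powr s" for i
      using L_le_1[of "[i]"] J_pos[of "[i]"] powr_mono'[of s 0 "L [i]"] by simp
    then show False using LIMSEQ_le_const[OF summable_LIMSEQ_zero[OF sm], of 1] by auto
  qed
  have dim_eq: "coded_measure a b T p = distr (bernoulli_measure p) borel code" for p
    by (simp add: coded_measure_def coding_map_eq_code)
  have "ereal s < measure_dim (distr (bernoulli_measure p0) borel code)"
    using r(2) s(2) by (metis dim_eq ereal_less_ereal_Ex less_ereal.simps(1) order_less_trans)
  from dimension_maximizer_exists[OF s0 sm p0(1) this] obtain p' where
    p': "prob_vector p'" "\<And>p. prob_vector p \<Longrightarrow> measure_dim (coded_measure a b T p) \<le> measure_dim (coded_measure a b T p')"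
    unfolding dim_eq by blast
  have "(SUP p\<in>{p. prob_vector p}. measure_dim (coded_measure a b T p)) = measure_dim (coded_measure a b T p')"
    using p' by (intro antisym SUP_least SUP_upper) auto
  then show ?thesis using p'(1) by blast
qed

end
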